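(* Let $\mu,\mu_1,\mu_2,\ldots$ be finite Borel measures on $S$. Assume: (A1) the transition density $p$ is jointly continuous on $(0,\infty)\times S\times S$ with values in $[0,\infty)$; (A2) each of $\mu,\mu_1,\mu_2,\ldots$ charges no semipolar sets, and $\mu_n\to\mu$ weakly; (A3) there exists a compact subset $K_0$ of $S$ such that $\operatorname{supp}(\mu_n)\subseteq K_0$ for all $n\ge1$ and $\operatorname{supp}(\mu)\subseteq K_0$; (A4) for any compact subset $K$ of $S$, $$\lim_{t\to0}\ \sup_{n\ge1}\ \sup_{x\in K}\int_0^t\int_S p_s(x,y)\,\mu_n(dy)\,ds=0 .$$ Then $\mu\in\mathcal S_{00}$, $\mu_n\in\mathcal S_{00}$ for all $n\ge1$, and $$\lim_{n\to\infty}\|R_1\mu_n-R_1\mu\|_{L^\infty(S,\mu_n+\mu)}=0 .$$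
   Context: Setting. $S$ is a locally compact separable metrizable space; $S_\Delta=S\cup\{\Delta\}$ is its one-point compactification ($\Delta$ isolated if $S$ is compact). Functions $f$ on $S$ are extended by $f(\Delta)=0$; $\inf\emptyset=\infty$. $X=(\Omega,\mathscr M,(X_t)_{t\in[0,\infty]},(P_x)_{x\in S_\Delta},(\theta_t)_{t\in[0,\infty]})$ is a standard process on $S$ (a normal, right-continuous strong Markov process with cemetery $\Delta$, having left limits and quasi-left-continuous on $[0,\zeta)$, where $\zeta=\inf\{t: X_t=\Delta\}$ is the lifetime; $X_\infty=\Delta$; $\theta_t$ are shift operators). Standing assumption (duality and absolute continuity): there exist another standard process $\hat X$ on $S$ with laws $\hat P_x$, a $\sigma$-finite Borel measure $m$ on $S$ and a Borel measurable function $p:(0,\infty)\times S\times S\to[0,\infty]$ (the transition density) such that for all $s,t>0$, $x,y\in S$: $P_x(X_t\in dy)=p_t(x,y)\,m(dy)$; $\hat P_y(\hat X_t\in dx)=p_t(x,y)\,m(dx)$; $p_{t+s}(x,y)=\int_S p_t(x,z)p_s(z,y)\,m(dz)$. Notation. $r_1(x,y)=\int_0^\infty e^{-t}p_t(x,y)\,dt$ and, for a Borel measure $\mu$, $R_1\mu(x)=\int_S r_1(x,y)\,\mu(dy)$. $\|f\|_\infty=\sup_{x\in S}|f(x)|$; $\|f\|_{L^\infty(S,\nu)}=\inf\{C>0:|f|\le C\ \nu\text{-a.e.}\}$. $\operatorname{supp}(\nu)$ is the topological support of $\nu$. For Borel $E\subseteq S$, $\sigma_E=\inf\{t\in(0,\infty):X_t\in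 E\}$. A set is thin if it is contained in a nearly Borel set $B$ with $P_x(\sigma_B=0)=0$ for all $x$; a set is semipolar if it is contained in a countable union of thin sets. $\mathcal S_{00}$ is the set of finite Borel measures $\mu$ on $S$ charging no semipolar set with $\|R_1\mu\|_\infty<\infty$. *)

theory Defs
  imports "HOL-Probability.Probability"
begin

text \<open>
  The state space \<open>S\<close> is the universe of a type \<open>'a :: {metric_space, second_countable_topology}\<close>
  (a metric space is separable iff it is second countable); local compactness is a separate
  hypothesis.  The cemetery is \<^term>\<open>None\<close>, a point \<open>x\<close> of \<open>S\<close> is \<^term>\<open>Some x\<close>, and the time
  set \<open>[0, \<infinity>]\<close> is \<^typ>\<open>ennreal\<close>.
\<close>

abbreviation cemetery_topology :: "'a::topological_space option topology" where
  "cemetery_topology \<equiv> Alexandroff_compactification (euclidean :: 'a topology)"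

definition cemetery_borel :: "'a::topological_space option measure" where
  "cemetery_borel = sigma UNIV {U. openin cemetery_topology U}"


section \<open>Standard processes\<close>

text \<open>
  \<open>(\<Omega>, M, X, P, \<theta>)\<close>: \<open>space (events Z)\<close> is \<open>\<Omega>\<close> and \<open>sets (events Z)\<close> is \<open>M\<close>; the measure
  carried by \<open>events Z\<close> itself plays no role.
\<close>

record ('w, 'a) process =
  events :: "'w measure"
  coord :: "ennreal \<Rightarrow> 'w \<Rightarrow> 'a option"
  law :: "'a option \<Rightarrow> 'w measure"
  shift :: "ennreal \<Rightarrow> 'w \<Rightarrow> 'w"

definition lifetime :: "('w, 'a) process \<Rightarrow> 'w \<Rightarrow> ennreal" where
  "lifetime Z \<omega> = Inf {t. coord Z t \<omega> = None}"

definition natural_filtration ::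
  "('w, 'a::topological_space) process \<Rightarrow> ennreal \<Rightarrow> 'w measure" where
  "natural_filtration Z t = sigma (space (events Z))
     {coord Z s -` B \<inter> space (events Z) | s B. s \<le> t \<and> B \<in> sets cemetery_borel}"

text \<open>\<open>P\<^sub>\<mu> = \<integral> P\<^sub>x \<mu>(dx)\<close>, a measure on the \<open>\<sigma>\<close>-algebra generated by all the \<open>X\<^sub>t\<close>.\<close>

definition initial_law ::
  "('w, 'a::topological_space) process \<Rightarrow> 'a option measure \<Rightarrow> 'w measure" where
  "initial_law Z \<mu> = \<mu> \<bind> (\<lambda>x. restr_to_subalg (law Z x) (natural_filtration Z \<infinity>))"

text \<open>
  The minimal augmented filtration: the intersection over all initial distributions \<open>\<mu>\<close> of the
  natural filtration enlarged by the \<open>P\<^sub>\<mu>\<close>-null sets.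
\<close>

definition augmented_filtration ::
  "('w, 'a::topological_space) process \<Rightarrow> ennreal \<Rightarrow> 'w measure" where
  "augmented_filtration Z t = sigma (space (events Z))
     {A. A \<subseteq> space (events Z) \<and>
         (\<forall>\<mu>\<in>space (prob_algebra cemetery_borel). \<exists>B\<in>sets (natural_filtration Z t).
            AE \<omega> in initial_law Z \<mu>. \<omega> \<in> A \<longleftrightarrow> \<omega> \<in> B)}"

abbreviation stopped_sigma ::
  "('w, 'a::topological_space) process \<Rightarrow> ('w \<Rightarrow> ennreal) \<Rightarrow> 'w measure" where
  "stopped_sigma Z T \<equiv> filtration.pre_sigma (space (events Z)) (augmented_filtration Z) T"

text \<open>
  Stopping times need only be measurable for the augmented filtration, hence the completions.
\<close>

locale standard_process =
  fixes Z :: "('w, 'a::{metric_space, second_countable_topology}) process"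
  assumes prob_law: "prob_space (law Z x)"
    and sets_law: "sets (law Z x) = sets (events Z)"
    and coord_measurable: "coord Z t \<in> measurable (events Z) cemetery_borel"
    and law_measurable: "B \<in> sets cemetery_borel \<Longrightarrow>
      (\<lambda>x. emeasure (law Z x) {\<omega>\<in>space (events Z). coord Z t \<omega> \<in> B})
        \<in> borel_measurable cemetery_borel"
    and normal: "AE \<omega> in law Z x. coord Z 0 \<omega> = x"
    and coord_infinity: "\<omega> \<in> space (events Z) \<Longrightarrow> coord Z \<infinity> \<omega> = None"
    and cemetery_absorbing:
      "\<lbrakk>\<omega> \<in> space (events Z); coord Z s \<omega> = None; s \<le> t\<rbrakk> \<Longrightarrow> coord Z t \<omega> = None"
    and shift_space: "\<omega> \<in> space (events Z) \<Longrightarrow> shift Z t \<omega> \<in> space (events Z)"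
    and coord_shift:
      "\<omega> \<in> space (events Z) \<Longrightarrow> coord Z s (shift Z t \<omega>) = coord Z (t + s) \<omega>"
    and right_continuous: "\<lbrakk>\<omega> \<in> space (events Z); t < \<infinity>\<rbrakk> \<Longrightarrow>
      limitin cemetery_topology (\<lambda>s. coord Z s \<omega>) (coord Z t \<omega>) (at_right t)"
    and right_continuous_filtration: "t < \<infinity> \<Longrightarrow>
      (\<Inter>s\<in>{t<..}. sets (augmented_filtration Z s)) = sets (augmented_filtration Z t)"
    and coord_stopping_measurable: "stopping_time (augmented_filtration Z) T \<Longrightarrow>
      (\<lambda>\<omega>. coord Z (T \<omega>) \<omega>) \<in> measurable (stopped_sigma Z T) cemetery_borel"
    and strong_Markov:
      "\<lbrakk>stopping_time (augmented_filtration Z) T; B \<in> sets cemetery_borel\<rbrakk> \<Longrightarrow>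
       AE \<omega> in law Z x.
         nn_cond_exp (completion (law Z x)) (stopped_sigma Z T)
           (indicator {\<omega>\<in>space (events Z). coord Z (T \<omega> + t) \<omega> \<in> B}) \<omega>
         = emeasure (law Z (coord Z (T \<omega>) \<omega>)) {\<omega>'\<in>space (events Z). coord Z t \<omega>' \<in> B}"
    and left_limits: "AE \<omega> in law Z x. \<forall>t. 0 < t \<and> t < lifetime Z \<omega> \<longrightarrow>
      (\<exists>y. limitin cemetery_topology (\<lambda>s. coord Z s \<omega>) (Some y) (at_left t))"
    and quasi_left_continuous:
      "\<lbrakk>\<And>n. stopping_time (augmented_filtration Z) (Ts n);
        \<And>n \<omega>. \<omega> \<in> space (events Z) \<Longrightarrow> Ts n \<omega> \<le> Ts (Suc n) \<omega>\<rbrakk> \<Longrightarrow>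
       AE \<omega> in law Z x. (SUP n. Ts n \<omega>) < lifetime Z \<omega> \<longrightarrow>
         limitin cemetery_topology (\<lambda>n. coord Z (Ts n \<omega>) \<omega>) (coord Z (SUP n. Ts n \<omega>) \<omega>)
           sequentially"


section \<open>Duality and absolute continuity\<close>

locale dual_standard_processes =
  X: standard_process X + Xh: standard_process Xh
  for X :: "('w, 'a::{metric_space, second_countable_topology}) process"
    and Xh :: "('v, 'a) process" +
  fixes m :: "'a measure" and p :: "real \<Rightarrow> 'a \<Rightarrow> 'a \<Rightarrow> ennreal"
  assumes sets_m: "sets m = sets borel"
    and sigma_finite_m: "sigma_finite_measure m"
    and density_measurable: "(\<lambda>(t, x, y). p t x y)
      \<in> borel_measurable (restrict_space (borel :: (real \<times> 'a \<times> 'a) measure) ({0<..} \<times> UNIV))"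
    and density: "\<lbrakk>0 < t; B \<in> sets borel\<rbrakk> \<Longrightarrow>
      emeasure (law X (Some x)) {\<omega>\<in>space (events X). coord X (ennreal t) \<omega> \<in> Some ` B}
        = (\<integral>\<^sup>+y\<in>B. p t x y \<partial>m)"
    and dual_density: "\<lbrakk>0 < t; B \<in> sets borel\<rbrakk> \<Longrightarrow>
      emeasure (law Xh (Some y)) {\<omega>\<in>space (events Xh). coord Xh (ennreal t) \<omega> \<in> Some ` B}
        = (\<integral>\<^sup>+x\<in>B. p t x y \<partial>m)"
    and Chapman_Kolmogorov: "\<lbrakk>0 < s; 0 < t\<rbrakk> \<Longrightarrow>
      p (t + s) x y = (\<integral>\<^sup>+z. p t x z * p s z y \<partial>m)"


section \<open>Exceptional sets\<close>

definition hitting_time :: "('w, 'a) process \<Rightarrow> 'a set \<Rightarrow> 'w \<Rightarrow> ennreal" where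
  "hitting_time Z E \<omega> = Inf {t. 0 < t \<and> t < \<infinity> \<and> coord Z t \<omega> \<in> Some ` E}"

definition nearly_borel :: "('w, 'a::topological_space) process \<Rightarrow> 'a set \<Rightarrow> bool" where
  "nearly_borel Z B \<longleftrightarrow>
     (\<forall>\<mu>\<in>space (prob_algebra cemetery_borel).
        \<exists>B1\<in>sets borel. \<exists>B2\<in>sets borel. B1 \<subseteq> B \<and> B \<subseteq> B2 \<and>
          (AE \<omega> in initial_law Z \<mu>. \<not> (\<exists>t<\<infinity>. coord Z t \<omega> \<in> Some ` (B2 - B1))))"

definition thin :: "('w, 'a::topological_space) process \<Rightarrow> 'a set \<Rightarrow> bool" where
  "thin Z A \<longleftrightarrow> (\<exists>B. A \<subseteq> B \<and> nearly_borel Z B \<and>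
     (\<forall>x. AE \<omega> in law Z (Some x). hitting_time Z B \<omega> \<noteq> 0))"

definition semipolar :: "('w, 'a::topological_space) process \<Rightarrow> 'a set \<Rightarrow> bool" where
  "semipolar Z A \<longleftrightarrow> (\<exists>B :: nat \<Rightarrow> 'a set. (\<forall>i. thin Z (B i)) \<and> A \<subseteq> (\<Union>i. B i))"

text \<open>Semipolar sets need not be Borel, so null sets are taken in the completion.\<close>

definition charges_no_semipolar ::
  "('w, 'a::topological_space) process \<Rightarrow> 'a measure \<Rightarrow> bool" where
  "charges_no_semipolar Z \<mu> \<longleftrightarrow> (\<forall>A. semipolar Z A \<longrightarrow> A \<in> null_sets (completion \<mu>))"


section \<open>Potentials and measures\<close>

definition resolvent_density :: "(real \<Rightarrow> 'a \<Rightarrow> 'a \<Rightarrow> ennreal) \<Rightarrow> 'a \<Rightarrow> 'a \<Rightarrow> ennreal" where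
  "resolvent_density p x y = (\<integral>\<^sup>+t\<in>{0<..}. ennreal (exp (- t)) * p t x y \<partial>lborel)"

definition potential :: "(real \<Rightarrow> 'a \<Rightarrow> 'a \<Rightarrow> ennreal) \<Rightarrow> 'a measure \<Rightarrow> 'a \<Rightarrow> ennreal" where
  "potential p \<mu> x = (\<integral>\<^sup>+y. resolvent_density p x y \<partial>\<mu>)"

definition S00 ::
  "('w, 'a::topological_space) process \<Rightarrow> (real \<Rightarrow> 'a \<Rightarrow> 'a \<Rightarrow> ennreal) \<Rightarrow> 'a measure set" where
  "S00 Z p = {\<mu>. finite_measure \<mu> \<and> sets \<mu> = sets borel \<and> charges_no_semipolar Z \<mu> \<and>
                 (SUP x. potential p \<mu> x) < \<infinity>}"

definition topological_support :: "'a::topological_space measure \<Rightarrow> 'a set" where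
  "topological_support \<nu> = {x. \<forall>U. open U \<and> x \<in> U \<longrightarrow> 0 < emeasure \<nu> U}"

definition weakly_converges ::
  "(nat \<Rightarrow> 'a::topological_space measure) \<Rightarrow> 'a measure \<Rightarrow> bool" where
  "weakly_converges \<mu>s \<mu> \<longleftrightarrow>
     (\<forall>f :: 'a \<Rightarrow> real. continuous_on UNIV f \<and> bounded (range f) \<longrightarrow>
        (\<lambda>n. \<integral>x. f x \<partial>\<mu>s n) \<longlonglongrightarrow> (\<integral>x. f x \<partial>\<mu>))"

definition measure_add :: "'a measure \<Rightarrow> 'a measure \<Rightarrow> 'a measure" where
  "measure_add \<mu> \<nu> = measure_of (space \<mu>) (sets \<mu>) (\<lambda>A. emeasure \<mu> A + emeasure \<nu> A)"

lemma space_measure_add [simp]: "space (measure_add \<mu> \<nu>) = space \<mu>"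
  and sets_measure_add [simp]: "sets (measure_add \<mu> \<nu>) = sets \<mu>"
  by (simp_all add: measure_add_def)

lemma emeasure_measure_add:
  assumes "sets \<nu> = sets \<mu>" "A \<in> sets \<mu>"
  shows "emeasure (measure_add \<mu> \<nu>) A = emeasure \<mu> A + emeasure \<nu> A"
  unfolding measure_add_def
proof (rule emeasure_measure_of_sigma)
  show "sigma_algebra (space \<mu>) (sets \<mu>)" by (rule sets.sigma_algebra_axioms)
  show "positive (sets \<mu>) (\<lambda>A. emeasure \<mu> A + emeasure \<nu> A)" by (simp add: positive_def)
  show "countably_additive (sets \<mu>) (\<lambda>A. emeasure \<mu> A + emeasure \<nu> A)"
    using assms(1) by (auto simp: countably_additive_def suminf_add[symmetric] suminf_emeasure)
qed fact

text \<open>The value is \<open>\<infinity>\<close> if \<open>f\<close> is not essentially bounded.\<close>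

definition Linfty_norm :: "'a measure \<Rightarrow> ('a \<Rightarrow> ereal) \<Rightarrow> ereal" where
  "Linfty_norm \<nu> f = Inf {ereal C | C. 0 < C \<and> (AE x in \<nu>. \<bar>f x\<bar> \<le> ereal C)}"

end

theory Submission
  imports Defs "HOL-Real_Asymp.Real_Asymp"
begin

text \<open>
  Let \<open>K\<close> be a compact neighbourhood of the common compact carrier \<open>K\<^sub>0\<close>.  The key point is a bound
  for the potentials of all the measures on all of \<open>S\<close>.  Discretise time with step \<open>d\<close>: the part
  of the potential after time \<open>d\<close> is \<open>\<Sum>\<^sub>k Q\<^sup>k G\<close>, where \<open>Q\<close> is the transition operator over time \<open>d\<close>,
  discounted by \<open>exp (- d)\<close>, and \<open>G = J (d, 2d]\<close> is the contribution of the times in \<open>(d, 2d]\<close>;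
  partial sums of \<open>\<Sum>\<^sub>k Q\<^sup>k f\<close> are denoted by \<open>U d f\<close>.  Split \<open>G\<close> into its restrictions to \<open>K\<close> and to the complement of \<open>K\<close>.  A discrete maximum principle bounds the
  potential of the first part by its small-time values on \<open>K\<close>, uniformly in \<open>d\<close> and in the measure.
  The \<open>m\<close>-integral of the potential of the second part tends to 0 with \<open>d\<close>, because the dual process
  started in \<open>K\<^sub>0\<close> stays inside \<open>K\<close> for short times.  Hence the bound holds \<open>m\<close>-almost everywhere,
  and everywhere after one more application of the semigroup.  It passes to \<open>\<mu>\<close> by Fatou's lemma.

  For the convergence on \<open>K\<^sub>0\<close>, the time interval is cut at \<open>t\<close> and \<open>T\<close>: times up to \<open>t\<close> contribute
  little by assumption (A4), times after \<open>T\<close> contribute at most \<open>exp (- T)\<close> times the bound, and in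
  between the kernel is uniformly continuous on a compact set, so weak convergence is uniform there.
\<close>

section \<open>Discounted kernels and a maximum principle\<close>

text \<open>All that the maximum principle and the time shifts use of the two processes: mass at
  most 1 in either space variable (one bound for each process), joint measurability and the
  semigroup identity.\<close>

locale dual_kernel = sigma_finite_measure m
  for m :: "'a::second_countable_topology measure" and p :: "real \<Rightarrow> 'a \<Rightarrow> 'a \<Rightarrow> ennreal" +
  assumes sets_m [measurable_cong]: "sets m = sets borel"
    and kernel_measurable: "(\<lambda>(t, x, y). p t x y) \<in> borel_measurable borel"
    and mass_le_1: "0 < t \<Longrightarrow> (\<integral>\<^sup>+y. p t x y \<partial>m) \<le> 1"
    and dual_mass_le_1: "0 < t \<Longrightarrow> (\<integral>\<^sup>+x. p t x y \<partial>m) \<le> 1"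
    and semigroup: "0 < s \<Longrightarrow> 0 < t \<Longrightarrow> p (t + s) x y = (\<integral>\<^sup>+z. p t x z * p s z y \<partial>m)"
begin

lemma measurable_kernel [measurable (raw)]:
  assumes [measurable]: "f \<in> borel_measurable N" "g \<in> N \<rightarrow>\<^sub>M borel" "h \<in> N \<rightarrow>\<^sub>M borel"
  shows "(\<lambda>w. p (f w) (g w) (h w)) \<in> borel_measurable N"
proof -
  have "(\<lambda>w. (f w, g w, h w)) \<in> N \<rightarrow>\<^sub>M borel"
    by (subst borel_prod[symmetric], subst borel_prod[symmetric]) measurable
  from measurable_compose[OF this kernel_measurable] show ?thesis
    by simp
qed

definition Q :: "real \<Rightarrow> ('a \<Rightarrow> ennreal) \<Rightarrow> 'a \<Rightarrow> ennreal" where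
  "Q d f x = ennreal (exp (- d)) * (\<integral>\<^sup>+z. p d x z * f z \<partial>m)"

lemma Q_measurable [measurable]:
  assumes [measurable]: "f \<in> borel_measurable borel"
  shows "Q d f \<in> borel_measurable borel"
  unfolding Q_def by measurable

lemma Q_power_measurable [measurable]:
  assumes "f \<in> borel_measurable borel"
  shows "(Q d ^^ k) f \<in> borel_measurable borel"
  by (induction k) (auto intro: assms Q_measurable)

lemma Q_mono: "(\<And>z. f z \<le> g z) \<Longrightarrow> Q d f x \<le> Q d g x"
  unfolding Q_def by (intro mult_left_mono nn_integral_mono) auto

lemma Q_power_mono: "(\<And>z. f z \<le> g z) \<Longrightarrow> (Q d ^^ k) f x \<le> (Q d ^^ k) g x"
  by (induction k arbitrary: x) (auto intro: Q_mono)

lemma Q_zero: "Q d (\<lambda>_. 0) x = 0"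
  by (simp add: Q_def)

lemma Q_add:
  assumes "f \<in> borel_measurable borel" "g \<in> borel_measurable borel"
  shows "Q d (\<lambda>z. f z + g z) x = Q d f x + Q d g x"
  unfolding Q_def using assms by (simp add: distrib_left nn_integral_add)

lemma Q_power_add:
  assumes "f \<in> borel_measurable borel" "g \<in> borel_measurable borel"
  shows "(Q d ^^ k) (\<lambda>z. f z + g z) x = (Q d ^^ k) f x + (Q d ^^ k) g x"
proof (induction k arbitrary: x)
  case (Suc k)
  have "(Q d ^^ k) (\<lambda>z. f z + g z) = (\<lambda>z. (Q d ^^ k) f z + (Q d ^^ k) g z)"
    using Suc.IH by blast
  then show ?case
    using assms by (simp add: Q_add)
qed simp

lemma Q_sum:
  assumes "\<And>i. i \<in> I \<Longrightarrow> f i \<in> borel_measurable borel"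
  shows "Q d (\<lambda>z. \<Sum>i\<in>I. f i z) x = (\<Sum>i\<in>I. Q d (f i) x)"
  using assms
proof (induction I rule: infinite_finite_induct)
  case (insert i I)
  have "(\<lambda>z. \<Sum>i\<in>I. f i z) \<in> borel_measurable borel"
    using insert.prems by measurable
  then show ?case
    using insert by (simp add: Q_add)
qed (simp_all add: Q_zero)

lemma Q_const_le:
  assumes "0 < d"
  shows "Q d (\<lambda>_. c) x \<le> ennreal (exp (- d)) * c"
proof -
  have "(\<integral>\<^sup>+z. p d x z * c \<partial>m) = (\<integral>\<^sup>+z. p d x z \<partial>m) * c"
    by (rule nn_integral_multc) measurable
  also have "\<dots> \<le> 1 * c"
    using mass_le_1[OF assms] by (rule mult_right_mono) simp
  finally show ?thesis
    by (simp add: Q_def mult_left_mono)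
qed

lemma Q_power_const_le: "0 < d \<Longrightarrow> (Q d ^^ k) (\<lambda>_. c) x \<le> ennreal (exp (- (real k * d))) * c"
proof (induction k arbitrary: x)
  case (Suc k)
  have "(Q d ^^ Suc k) (\<lambda>_. c) x \<le> Q d (\<lambda>_. ennreal (exp (- (real k * d))) * c) x"
    using Suc by (auto intro: Q_mono)
  also have "\<dots> \<le> ennreal (exp (- d)) * (ennreal (exp (- (real k * d))) * c)"
    using Suc.prems by (rule Q_const_le)
  also have "\<dots> = ennreal (exp (- (real (Suc k) * d))) * c"
    by (simp add: mult.assoc[symmetric] ennreal_mult[symmetric] exp_add[symmetric] algebra_simps)
  finally show ?case .
qed simp

text \<open>Tonelli moves the \<open>m\<close>-integral onto the first space variable of
  \<open>p\<close>, where the mass bound of the dual process applies. Thus \<open>Q d\<close>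
  contracts not only the supremum but also the \<open>m\<close>-integral by the factor
  \<open>exp (- d)\<close>.\<close>

lemma nn_integral_Q_le:
  assumes [measurable]: "f \<in> borel_measurable borel" and "0 < d"
  shows "(\<integral>\<^sup>+x. Q d f x \<partial>m) \<le> ennreal (exp (- d)) * (\<integral>\<^sup>+x. f x \<partial>m)"
proof -
  interpret mm: pair_sigma_finite m m ..
  have "(\<integral>\<^sup>+x. Q d f x \<partial>m) = ennreal (exp (- d)) * (\<integral>\<^sup>+x. \<integral>\<^sup>+z. p d x z * f z \<partial>m \<partial>m)"
    unfolding Q_def by (rule nn_integral_cmult) measurable
  also have "(\<integral>\<^sup>+x. \<integral>\<^sup>+z. p d x z * f z \<partial>m \<partial>m) = (\<integral>\<^sup>+z. \<integral>\<^sup>+x. p d x z * f z \<partial>m \<partial>m)"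
    by (rule mm.Fubini'[symmetric]) measurable
  also have "\<dots> = (\<integral>\<^sup>+z. (\<integral>\<^sup>+x. p d x z \<partial>m) * f z \<partial>m)"
    by (intro nn_integral_cong nn_integral_multc) measurable
  also have "\<dots> \<le> (\<integral>\<^sup>+z. 1 * f z \<partial>m)"
    using assms by (intro nn_integral_mono mult_right_mono dual_mass_le_1) auto
  finally show ?thesis
    by (simp add: mult_left_mono)
qed

lemma nn_integral_Q_power_le:
  assumes "f \<in> borel_measurable borel" and "0 < d"
  shows "(\<integral>\<^sup>+x. (Q d ^^ k) f x \<partial>m) \<le> ennreal (exp (- d) ^ k) * (\<integral>\<^sup>+x. f x \<partial>m)"
proof (induction k)
  case (Suc k)
  have "(\<integral>\<^sup>+x. (Q d ^^ Suc k) f x \<partial>m) \<le> ennreal (exp (- d)) * (\<integral>\<^sup>+x. (Q d ^^ k) f x \<partial>m)"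
    using assms nn_integral_Q_le by simp
  also have "\<dots> \<le> ennreal (exp (- d)) * (ennreal (exp (- d) ^ k) * (\<integral>\<^sup>+x. f x \<partial>m))"
    using Suc by (intro mult_left_mono) auto
  finally show ?case
    by (simp add: mult.assoc[symmetric] ennreal_mult[symmetric])
qed simp

section \<open>Partial sums of the discretised potential\<close>

definition U :: "real \<Rightarrow> ('a \<Rightarrow> ennreal) \<Rightarrow> nat \<Rightarrow> 'a \<Rightarrow> ennreal" where
  "U d f N x = (\<Sum>k<N. (Q d ^^ k) f x)"

lemma U_measurable [measurable]: "f \<in> borel_measurable borel \<Longrightarrow> U d f N \<in> borel_measurable borel"
  unfolding U_def by measurable

lemma U_mono_fun: "(\<And>z. f z \<le> g z) \<Longrightarrow> U d f N x \<le> U d g N x"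
  unfolding U_def by (intro sum_mono Q_power_mono)

lemma U_mono: "N \<le> N' \<Longrightarrow> U d f N x \<le> U d f N' x"
  unfolding U_def by (intro sum_mono2) auto

lemma Q_power_U:
  assumes "f \<in> borel_measurable borel"
  shows "(Q d ^^ j) (U d f N) x = (\<Sum>k<N. (Q d ^^ (j + k)) f x)"
proof (induction j arbitrary: x)
  case 0
  then show ?case
    by (simp add: U_def)
next
  case (Suc j)
  have "(Q d ^^ j) (U d f N) = (\<lambda>z. \<Sum>k<N. (Q d ^^ (j + k)) f z)"
    using Suc.IH by (rule ext)
  then have "(Q d ^^ Suc j) (U d f N) x = Q d (\<lambda>z. \<Sum>k<N. (Q d ^^ (j + k)) f z) x"
    by simp
  also have "\<dots> = (\<Sum>k<N. Q d ((Q d ^^ (j + k)) f) x)"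
    using assms by (intro Q_sum) measurable
  finally show ?case
    by simp
qed

lemma U_split:
  assumes "f \<in> borel_measurable borel"
  shows "U d f (j + N) x = U d f j x + (Q d ^^ j) (U d f N) x"
proof -
  have "U d f (j + N) x = (\<Sum>k<j. (Q d ^^ k) f x) + (\<Sum>k=j..<j+N. (Q d ^^ k) f x)"
    unfolding U_def lessThan_atLeast0 by (simp add: sum.atLeastLessThan_concat)
  also have "(\<Sum>k=j..<j+N. (Q d ^^ k) f x) = (\<Sum>k<N. (Q d ^^ (j + k)) f x)"
    using sum.shift_bounds_nat_ivl[of "\<lambda>k. (Q d ^^ k) f x" 0 j N]
    by (simp add: lessThan_atLeast0 add.commute)
  finally show ?thesis
    by (simp only: Q_power_U[OF assms] U_def)
qed

lemma U_add:
  assumes "f \<in> borel_measurable borel" "g \<in> borel_measurable borel"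
  shows "U d (\<lambda>z. f z + g z) N x = U d f N x + U d g N x"
  unfolding U_def by (simp add: Q_power_add assms sum.distrib)

text \<open>
  A maximum principle: outside \<open>K\<close> the partial potential satisfies \<open>u\<^bsub>N+1\<^esub> = Q u\<^sub>N\<close>, and on
  \<open>K\<close> everything after the first \<open>j\<close> steps is discounted by \<open>exp (- j d)\<close>.
\<close>

lemma U_le:
  assumes f: "f \<in> borel_measurable borel" and d: "0 < d"
    and off: "\<And>x. x \<notin> K \<Longrightarrow> f x = 0"
    and on: "\<And>x. x \<in> K \<Longrightarrow> U d f j x \<le> a"
    and C: "a + ennreal (exp (- (real j * d))) * C \<le> C"
    and j: "0 < j"
  shows "U d f N x \<le> C"
\<comment> \<open>Strong induction is required: off \<open>K\<close> the number of steps drops by 1,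
  on \<open>K\<close> it drops by \<open>j\<close>.\<close>
proof (induction N arbitrary: x rule: less_induct)
  case (less N)
  show ?case
  proof (cases "x \<in> K")
    case False
    show ?thesis
    proof (cases N)
      case 0
      then show ?thesis
        by (simp add: U_def)
    next
      case (Suc M)
      have "U d f N x = Q d (U d f M) x"
        using U_split[OF f, of d 1 M x] False Suc off by (simp add: U_def)
      also have "\<dots> \<le> Q d (\<lambda>_. C) x"
        using less Suc by (intro Q_mono) auto
      also have "\<dots> \<le> ennreal (exp (- d)) * C"
        using d by (rule Q_const_le)
      also have "\<dots> \<le> 1 * C"
        using d by (intro mult_right_mono) auto
      finally show ?thesis
        by simp
    qed
  next
    case True
    show ?thesis
    proof (cases "N \<le> j")
      case True
      have "U d f N x \<le> a"
        using U_mono[OF True] on[OF \<open>x \<in> K\<close>] order_trans by blast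
      also have "a \<le> C"
        using add_mono[OF order_refl[of a] zero_le] C by (metis add.right_neutral order_trans)
      finally show ?thesis .
    next
      case False
      then have "U d f N x = U d f j x + (Q d ^^ j) (U d f (N - j)) x"
        using U_split[OF f, of d j "N - j" x] by simp
      moreover have "(Q d ^^ j) (U d f (N - j)) x \<le> (Q d ^^ j) (\<lambda>_. C) x"
        using less j False by (intro Q_power_mono) auto
      moreover have "\<dots> \<le> ennreal (exp (- (real j * d))) * C"
        using d by (rule Q_power_const_le)
      ultimately have "U d f N x \<le> a + ennreal (exp (- (real j * d))) * C"
        using add_mono[OF on[OF \<open>x \<in> K\<close>] order_trans] by simp
      then show ?thesis
        using C by (rule order_trans)
    qed
  qed
qed

text \<open>A geometric series of contractions, so the bound is free of \<open>N\<close>. The factor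
  grows like \<open>1 / d\<close> for small \<open>d\<close>; \<open>nn_integral_J_off_le\<close>
  compensates for this.\<close>

lemma nn_integral_U_le:
  assumes [measurable]: "f \<in> borel_measurable borel" and d: "0 < d"
  shows "(\<integral>\<^sup>+x. U d f N x \<partial>m) \<le> ennreal (1 / (1 - exp (- d))) * (\<integral>\<^sup>+x. f x \<partial>m)"
proof -
  have "(\<integral>\<^sup>+x. U d f N x \<partial>m) = (\<Sum>k<N. \<integral>\<^sup>+x. (Q d ^^ k) f x \<partial>m)"
    unfolding U_def by (rule nn_integral_sum) measurable
  also have "\<dots> \<le> (\<Sum>k<N. ennreal (exp (- d) ^ k) * (\<integral>\<^sup>+x. f x \<partial>m))"
    using assms by (intro sum_mono nn_integral_Q_power_le)
  also have "\<dots> = ennreal (\<Sum>k<N. exp (- d) ^ k) * (\<integral>\<^sup>+x. f x \<partial>m)"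
    by (simp add: sum_distrib_right[symmetric] sum_ennreal)
  also have "\<dots> \<le> ennreal (1 / (1 - exp (- d))) * (\<integral>\<^sup>+x. f x \<partial>m)"
  proof (intro mult_right_mono ennreal_leI)
    have "(\<Sum>k<N. exp (- d) ^ k) \<le> (\<Sum>k. exp (- d) ^ k)"
      using d by (intro sum_le_suminf summable_geometric) auto
    also have "\<dots> = 1 / (1 - exp (- d))"
      using d by (intro suminf_geometric) auto
    finally show "(\<Sum>k<N. exp (- d) ^ k) \<le> 1 / (1 - exp (- d))" .
  qed simp
  finally show ?thesis .
qed

end

section \<open>Time windows of the potential of a measure\<close>

locale dual_kernel_measure = dual_kernel m p + mu: finite_measure \<mu>
  for m :: "'a::second_countable_topology measure" and p and \<mu> :: "'a measure" +
  assumes sets_mu [measurable_cong]: "sets \<mu> = sets borel"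
begin

text \<open>Keeping the time set as a parameter makes \<open>J\<close> a measure in
  \<open>A\<close>: windows can be added, translated by \<open>Q\<close> and exhausted from below.
  The weight \<open>exp (- s)\<close> is the one that matches the discount in
  \<open>Q\<close>.\<close>

definition J :: "real set \<Rightarrow> 'a \<Rightarrow> ennreal" where
  "J A x = (\<integral>\<^sup>+s\<in>A. ennreal (exp (- s)) * (\<integral>\<^sup>+y. p s x y \<partial>\<mu>) \<partial>lborel)"

lemma J_measurable [measurable]:
  assumes [measurable]: "A \<in> sets borel"
  shows "J A \<in> borel_measurable borel"
  unfolding J_def by measurable

lemma J_mono: "A \<subseteq> B \<Longrightarrow> J A x \<le> J B x"
  unfolding J_def by (intro nn_integral_mono) (auto split: split_indicator)

lemma J_union:
  assumes [measurable]: "A \<in> sets borel" "B \<in> sets borel" and "A \<inter> B = {}"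
  shows "J (A \<union> B) x = J A x + J B x"
proof -
  let ?g = "\<lambda>s. ennreal (exp (- s)) * (\<integral>\<^sup>+y. p s x y \<partial>\<mu>)"
  have "J (A \<union> B) x = (\<integral>\<^sup>+s. ?g s * indicator A s + ?g s * indicator B s \<partial>lborel)"
    unfolding J_def using assms(3) by (intro nn_integral_cong) (auto split: split_indicator)
  also have "\<dots> = J A x + J B x"
    unfolding J_def by (rule nn_integral_add) measurable
  finally show ?thesis .
qed

text \<open>By Tonelli and Chapman-Kolmogorov, \<open>p d\<close> followed by \<open>p s\<close> is
  \<open>p (d + s)\<close>, and the discounts multiply accordingly; hence \<open>Q d\<close>
  translates the time set by \<open>d\<close>. The times in \<open>A\<close> have to be positive for
  the semigroup identity to apply.\<close>

lemma Q_J: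
  assumes d: "0 < d" and [measurable]: "A \<in> sets borel" and A: "A \<subseteq> {0<..}"
  shows "Q d (J A) x = J {s. s - d \<in> A} x"
proof -
  interpret lm: pair_sigma_finite lborel m ..
  interpret um: pair_sigma_finite m \<mu> ..
  have CK: "(\<integral>\<^sup>+z. p d x z * (\<integral>\<^sup>+y. p s z y \<partial>\<mu>) \<partial>m) = (\<integral>\<^sup>+y. p (d + s) x y \<partial>\<mu>)" if "0 < s" for s
  proof -
    have "(\<integral>\<^sup>+z. p d x z * (\<integral>\<^sup>+y. p s z y \<partial>\<mu>) \<partial>m) = (\<integral>\<^sup>+z. \<integral>\<^sup>+y. p d x z * p s z y \<partial>\<mu> \<partial>m)"
      by (intro nn_integral_cong nn_integral_cmult[symmetric]) measurable
    also have "\<dots> = (\<integral>\<^sup>+y. \<integral>\<^sup>+z. p d x z * p s z y \<partial>m \<partial>\<mu>)"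
      by (rule um.Fubini'[symmetric]) measurable
    finally show ?thesis
      using semigroup[OF that d] by simp
  qed
  have "Q d (J A) x = ennreal (exp (- d)) * (\<integral>\<^sup>+z. \<integral>\<^sup>+s. p d x z *
      (ennreal (exp (- s)) * (\<integral>\<^sup>+y. p s z y \<partial>\<mu>) * indicator A s) \<partial>lborel \<partial>m)"
    unfolding Q_def J_def
    by (intro arg_cong2[where f="(*)"] refl nn_integral_cong nn_integral_cmult[symmetric]) measurable
  also have "\<dots> = ennreal (exp (- d)) * (\<integral>\<^sup>+s. \<integral>\<^sup>+z. p d x z *
      (ennreal (exp (- s)) * (\<integral>\<^sup>+y. p s z y \<partial>\<mu>) * indicator A s) \<partial>m \<partial>lborel)"
    by (rule arg_cong[OF lm.Fubini']) measurable
  also have "\<dots> = (\<integral>\<^sup>+s. ennreal (exp (- d)) * (\<integral>\<^sup>+z. p d x z *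
      (ennreal (exp (- s)) * (\<integral>\<^sup>+y. p s z y \<partial>\<mu>) * indicator A s) \<partial>m) \<partial>lborel)"
    by (rule nn_integral_cmult[symmetric]) measurable
  also have "\<dots> = (\<integral>\<^sup>+s. ennreal (exp (- (d + s))) * (\<integral>\<^sup>+y. p (d + s) x y \<partial>\<mu>) * indicator A s \<partial>lborel)"
  proof (rule nn_integral_cong)
    fix s :: real
    show "ennreal (exp (- d)) * (\<integral>\<^sup>+z. p d x z *
        (ennreal (exp (- s)) * (\<integral>\<^sup>+y. p s z y \<partial>\<mu>) * indicator A s) \<partial>m)
      = ennreal (exp (- (d + s))) * (\<integral>\<^sup>+y. p (d + s) x y \<partial>\<mu>) * indicator A s"
    proof (cases "s \<in> A")
      case True
      then have s: "0 < s"
        using A by auto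
      have "(\<integral>\<^sup>+z. p d x z * (ennreal (exp (- s)) * (\<integral>\<^sup>+y. p s z y \<partial>\<mu>) * indicator A s) \<partial>m)
          = (\<integral>\<^sup>+z. ennreal (exp (- s)) * (p d x z * (\<integral>\<^sup>+y. p s z y \<partial>\<mu>)) \<partial>m)"
        using True by (intro nn_integral_cong) (simp add: mult_ac)
      also have "\<dots> = ennreal (exp (- s)) * (\<integral>\<^sup>+y. p (d + s) x y \<partial>\<mu>)"
        by (subst nn_integral_cmult, measurable) (simp add: CK[OF s])
      finally show ?thesis
        using True
        by (simp add: mult.assoc[symmetric] ennreal_mult[symmetric] exp_add[symmetric] add.commute)
    qed simp
  qed
  \<comment> \<open>Translation invariance of Lebesgue measure, read from right to left:
    substituting \<open>d + s\<close> for \<open>s\<close> on the right gives the left.\<close>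
  also have "\<dots> = (\<integral>\<^sup>+s. ennreal (exp (- s)) * (\<integral>\<^sup>+y. p s x y \<partial>\<mu>) * indicator A (s - d) \<partial>lborel)"
    using nn_integral_real_affine[where c=1 and t=d
          and f="\<lambda>s. ennreal (exp (- s)) * (\<integral>\<^sup>+y. p s x y \<partial>\<mu>) * indicator A (s - d)"]
    by simp
  also have "\<dots> = J {s. s - d \<in> A} x"
    unfolding J_def by (intro nn_integral_cong) (simp split: split_indicator)
  finally show ?thesis .
qed

lemma Q_power_J:
  assumes d: "0 < d"
  shows "(Q d ^^ k) (J {d<..2 * d}) x = J {real (Suc k) * d<..real (Suc (Suc k)) * d} x"
proof (induction k arbitrary: x)
  case (Suc k)
  have "(Q d ^^ k) (J {d<..2 * d}) = J {real (Suc k) * d<..real (Suc (Suc k)) * d}"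
    using Suc.IH by (rule ext)
  then have "(Q d ^^ Suc k) (J {d<..2 * d}) x = Q d (J {real (Suc k) * d<..real (Suc (Suc k)) * d}) x"
    by simp
  also have "\<dots> = J {s. s - d \<in> {real (Suc k) * d<..real (Suc (Suc k)) * d}} x"
    using d by (intro Q_J) (auto intro: order.strict_trans[of 0 "(1 + real k) * d"])
  also have "{s. s - d \<in> {real (Suc k) * d<..real (Suc (Suc k)) * d}}
      = {real (Suc (Suc k)) * d<..real (Suc (Suc (Suc k))) * d}"
    by (auto simp: algebra_simps)
  finally show ?case .
qed simp

text \<open>The iterates of \<open>Q d\<close> on the first window are consecutive windows of length
  \<open>d\<close>, which are glued together. The window starts at \<open>d\<close> instead of 0, so
  \<open>N\<close> steps reach time \<open>(N + 1) d\<close>.\<close>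

lemma U_J:
  assumes d: "0 < d"
  shows "U d (J {d<..2 * d}) N x = J {d<..real (Suc N) * d} x"
proof (induction N)
  case 0
  then show ?case
    by (simp add: U_def J_def)
next
  case (Suc N)
  have "U d (J {d<..2 * d}) (Suc N) x
      = J {d<..real (Suc N) * d} x + J {real (Suc N) * d<..real (Suc (Suc N)) * d} x"
    using Suc Q_power_J[OF d] by (simp add: U_def)
  also have "\<dots> = J ({d<..real (Suc N) * d} \<union> {real (Suc N) * d<..real (Suc (Suc N)) * d}) x"
    by (rule J_union[symmetric]) auto
  also have "{d<..real (Suc N) * d} \<union> {real (Suc N) * d<..real (Suc (Suc N)) * d}
      = {d<..real (Suc (Suc N)) * d}"
    using d by (intro ivl_disj_un_two) (auto simp: algebra_simps)
  finally show ?case .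
qed

text \<open>\<open>J\<close> is the measure with density \<open>exp (- s)\<close> times the heat
  integral, so this is continuity from below.\<close>

lemma J_SUP:
  fixes A :: "nat \<Rightarrow> real set"
  assumes A: "\<And>n. A n \<in> sets borel" "incseq A"
  shows "(SUP n. J (A n) x) = J (\<Union>n. A n) x"
proof -
  let ?D = "density lborel (\<lambda>s. ennreal (exp (- s)) * (\<integral>\<^sup>+y. p s x y \<partial>\<mu>))"
  have "J B x = emeasure ?D B" if "B \<in> sets borel" for B
  proof -
    note that [measurable]
    show ?thesis
      unfolding J_def by (rule emeasure_density[symmetric]) measurable
  qed
  then show ?thesis
    using SUP_emeasure_incseq[of A ?D] A by (simp add: image_subset_iff)
qed

text \<open>The time window has length \<open>d\<close>, so its contribution off \<open>K\<close>
  has \<open>m\<close>-integral at most \<open>exp (- d) * e * d\<close>. This factor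
  \<open>d\<close> absorbs the geometric series constant from
  \<open>nn_integral_U_le\<close>.\<close>

lemma nn_integral_J_off_le:
  assumes [measurable]: "K \<in> sets borel" and d: "0 < d"
    and e: "\<And>r. 0 < r \<Longrightarrow> r \<le> 2 * d \<Longrightarrow> (\<integral>\<^sup>+z\<in>-K. (\<integral>\<^sup>+y. p r z y \<partial>\<mu>) \<partial>m) \<le> e"
  shows "ennreal (1 / (1 - exp (- d))) * (\<integral>\<^sup>+z\<in>-K. J {d<..2 * d} z \<partial>m) \<le> e"
proof -
  interpret lm: pair_sigma_finite lborel m ..
  have "(\<integral>\<^sup>+z\<in>-K. J {d<..2 * d} z \<partial>m) = (\<integral>\<^sup>+z. \<integral>\<^sup>+s. ennreal (exp (- s)) *
      (\<integral>\<^sup>+y. p s z y \<partial>\<mu>) * indicator {d<..2 * d} s * indicator (-K) z \<partial>lborel \<partial>m)"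
    unfolding J_def by (intro nn_integral_cong nn_integral_multc[symmetric]) measurable
  also have "\<dots> = (\<integral>\<^sup>+s. \<integral>\<^sup>+z. ennreal (exp (- s)) *
      (\<integral>\<^sup>+y. p s z y \<partial>\<mu>) * indicator {d<..2 * d} s * indicator (-K) z \<partial>m \<partial>lborel)"
    by (rule lm.Fubini') measurable
  also have "\<dots> \<le> (\<integral>\<^sup>+s. ennreal (exp (- d)) * e * indicator {d<..2 * d} s \<partial>lborel)"
  proof (rule nn_integral_mono)
    fix s :: real
    show "(\<integral>\<^sup>+z. ennreal (exp (- s)) * (\<integral>\<^sup>+y. p s z y \<partial>\<mu>) * indicator {d<..2 * d} s *
        indicator (-K) z \<partial>m) \<le> ennreal (exp (- d)) * e * indicator {d<..2 * d} s"
    proof (cases "s \<in> {d<..2 * d}")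
      case True
      then have "(\<integral>\<^sup>+z. ennreal (exp (- s)) * (\<integral>\<^sup>+y. p s z y \<partial>\<mu>) * indicator {d<..2 * d} s *
          indicator (-K) z \<partial>m) = ennreal (exp (- s)) * (\<integral>\<^sup>+z\<in>-K. (\<integral>\<^sup>+y. p s z y \<partial>\<mu>) \<partial>m)"
        by (subst nn_integral_cmult[symmetric], measurable) (simp add: mult.assoc)
      also have "\<dots> \<le> ennreal (exp (- d)) * e"
        using True d by (intro mult_mono ennreal_leI e) auto
      finally show ?thesis
        using True by simp
    qed simp
  qed
  also have "\<dots> = ennreal (exp (- d)) * e * ennreal d"
    using d by (subst nn_integral_cmult_indicator) auto
  finally have "ennreal (1 / (1 - exp (- d))) * (\<integral>\<^sup>+z\<in>-K. J {d<..2 * d} z \<partial>m)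
      \<le> ennreal (1 / (1 - exp (- d))) * (ennreal (exp (- d)) * e * ennreal d)"
    by (rule mult_left_mono) simp
  also have "\<dots> = ennreal (1 / (1 - exp (- d)) * exp (- d) * d) * e"
    using d by (simp add: ennreal_mult'[symmetric] mult_ac)
  also have "\<dots> \<le> 1 * e"
  proof (rule mult_right_mono)
    \<comment> \<open>Multiplying \<open>1 + d \<le> exp d\<close> by \<open>exp (- d)\<close>
      yields \<open>d * exp (- d) \<le> 1 - exp (- d)\<close>, which makes the total constant at
      most 1.\<close>
    have "(1 + d) * exp (- d) \<le> exp d * exp (- d)"
      by (intro mult_right_mono exp_ge_add_one_self) simp
    then have "exp (- d) * d \<le> 1 - exp (- d)"
      by (simp add: exp_minus_inverse algebra_simps)
    then show "ennreal (1 / (1 - exp (- d)) * exp (- d) * d) \<le> 1"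
      using d by simp
  qed simp
  finally show ?thesis
    by simp
qed

text \<open>The part after time \<open>T\<close> is \<open>Q T\<close> applied to the whole
  potential. Since \<open>Q T\<close> integrates against a density with respect to \<open>m\<close>,
  an almost everywhere bound is enough to give a bound at every point.\<close>

lemma J_tail_le:
  assumes T: "0 < T" and le: "AE x in m. J {0<..} x \<le> c"
  shows "J {T<..} x \<le> ennreal (exp (- T)) * c"
proof -
  have "J {T<..} x = Q T (J {0<..}) x"
    using T by (simp add: Q_J greaterThan_def)
  also have "\<dots> \<le> Q T (\<lambda>_. c) x"
    unfolding Q_def using le
    by (intro mult_left_mono nn_integral_mono_AE) (auto elim!: eventually_mono intro: mult_left_mono)
  also have "\<dots> \<le> ennreal (exp (- T)) * c"
    using T by (rule Q_const_le)
  finally show ?thesis .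
qed

lemma potential_eq_J: "potential p \<mu> x = J {0<..} x"
proof -
  interpret ul: pair_sigma_finite \<mu> lborel ..
  have "potential p \<mu> x = (\<integral>\<^sup>+t. \<integral>\<^sup>+y. ennreal (exp (- t)) * p t x y * indicator {0<..} t \<partial>\<mu> \<partial>lborel)"
    unfolding potential_def resolvent_density_def by (rule ul.Fubini'[symmetric]) measurable
  also have "\<dots> = J {0<..} x"
    unfolding J_def
    by (intro nn_integral_cong, subst nn_integral_multc, measurable, subst nn_integral_cmult) measurable
  finally show ?thesis .
qed

text \<open>The constant depends on \<open>t0\<close> alone, so it is common to all measures that
  admit the same \<open>t0\<close> in \<open>on\<close>. The convergence in \<open>off\<close> may
  have any rate: it only serves to remove an excess on an \<open>m\<close>-null set.\<close>

lemma J_le: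
  assumes K [measurable]: "K \<in> sets borel" and t0: "0 < t0"
    and on: "\<And>x. x \<in> K \<Longrightarrow> J {0<..t0} x \<le> 1"
    and off: "((\<lambda>r. \<integral>\<^sup>+z\<in>-K. (\<integral>\<^sup>+y. p r z y \<partial>\<mu>) \<partial>m) \<longlongrightarrow> 0) (at_right 0)"
  shows "J {0<..} x \<le> ennreal (1 / (1 - exp (- (t0 / 2))))"
proof -
  \<comment> \<open>\<open>C\<close> solves \<open>1 + q * C = C\<close>. The factor
    \<open>q\<close> dominates the discount \<open>exp (- j d)\<close> for every admissible
    \<open>j\<close>, because \<open>d = t0 / (1 + j)\<close> and \<open>1 \<le> j\<close> give
    \<open>t0 / 2 \<le> j d\<close>.\<close>
  define q where "q = exp (- (t0 / 2))"
  define C where "C = ennreal (1 / (1 - q))"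
  have q: "0 < q" "q < 1"
    using t0 by (auto simp: q_def)
  have inverse_Suc_antimono: "1 / real (Suc (Suc n)) \<le> 1 / real (Suc n)" for n
    by (intro divide_left_mono) auto
  \<comment> \<open>With this step size \<open>(j + 1) d = t0\<close>, so \<open>j\<close> steps
    cover exactly the times in \<open>(d, t0]\<close>, where hypothesis \<open>on\<close> provides
    the bound 1.\<close>
  have U_on: "U d (\<lambda>z. J {d<..2 * d} z * indicator K z) N x \<le> C"
    if j: "0 < j" and d: "d = t0 / (1 + real j)" for j d N x
  proof (rule U_le[where K=K and j=j and a=1])
    have d0: "0 < d"
      using t0 d by simp
    then show "0 < d" .
    have jd: "real (Suc j) * d = t0"
      using d by (simp add: field_simps)
    show "U d (\<lambda>z. J {d<..2 * d} z * indicator K z) j x \<le> 1" if x: "x \<in> K" for x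
    proof -
      have "U d (\<lambda>z. J {d<..2 * d} z * indicator K z) j x \<le> U d (J {d<..2 * d}) j x"
        by (intro U_mono_fun) (auto split: split_indicator)
      also have "\<dots> = J {d<..t0} x"
        using U_J[OF d0, of j x] jd by simp
      also have "\<dots> \<le> J {0<..t0} x"
        using d0 by (intro J_mono) auto
      finally show ?thesis
        using on[OF x] by simp
    qed
    have "1 \<le> real j"
      using j by simp
    then have "t0 / 2 \<le> real j * d"
      using t0 by (simp add: d field_simps)
    then have "exp (- (real j * d)) \<le> q"
      by (simp add: q_def)
    then have "1 + exp (- (real j * d)) * (1 / (1 - q)) \<le> 1 + q * (1 / (1 - q))"
      using q by (intro add_left_mono mult_right_mono) auto
    also have "\<dots> = 1 / (1 - q)"
      using q by (simp add: field_simps)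
    finally have "ennreal (1 + exp (- (real j * d)) * (1 / (1 - q))) \<le> C"
      unfolding C_def by (rule ennreal_leI)
    moreover have "ennreal (1 + exp (- (real j * d)) * (1 / (1 - q)))
        = 1 + ennreal (exp (- (real j * d))) * C"
      using q unfolding C_def by (subst ennreal_plus) (auto simp: ennreal_mult simp del: times_divide_eq_right)
    ultimately show "1 + ennreal (exp (- (real j * d))) * C \<le> C"
      by simp
  qed (use j in auto)
  \<comment> \<open>Subtraction in \<open>ennreal\<close> is truncated at 0, so the integrand is the
    excess over \<open>C\<close>. It is dominated by the potential of the part off \<open>K\<close>,
    whose \<open>m\<close>-integral can be made arbitrarily small.\<close>
  have excess_0: "(\<integral>\<^sup>+x. (J {d0<..M} x - C) \<partial>m) = 0" if d0: "0 < d0" for d0 M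
  proof (rule antisym)
    show "(\<integral>\<^sup>+x. (J {d0<..M} x - C) \<partial>m) \<le> 0"
    proof (rule ennreal_le_epsilon)
      fix e :: real assume e: "0 < e"
      have "eventually (\<lambda>r. (\<integral>\<^sup>+z\<in>-K. (\<integral>\<^sup>+y. p r z y \<partial>\<mu>) \<partial>m) < ennreal e) (at_right 0)"
        using order_tendstoD(2)[OF off, of "ennreal e"] e by simp
      then obtain b where b: "0 < b" and
        small: "\<And>r. 0 < r \<Longrightarrow> r < b \<Longrightarrow> (\<integral>\<^sup>+z\<in>-K. (\<integral>\<^sup>+y. p r z y \<partial>\<mu>) \<partial>m) < ennreal e"
        unfolding eventually_at_right_field by auto
      have "(\<lambda>j. t0 / (1 + real j)) \<longlonglongrightarrow> 0"
        by real_asymp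
      then have "eventually (\<lambda>j. t0 / (1 + real j) < min d0 (b / 2)) sequentially"
        using d0 b by (intro order_tendstoD) auto
      \<comment> \<open>The bound \<open>d0\<close> makes \<open>(d0, M]\<close> lie to the right of
        \<open>d\<close>; the bound \<open>b / 2\<close> keeps all times up to \<open>2 d\<close> in
        the range where the mass off \<open>K\<close> is below \<open>e\<close>.\<close>
      then obtain j where j: "0 < j" "t0 / (1 + real j) < min d0 (b / 2)"
        using eventually_gt_at_top[of 0] eventually_conj eventually_happens
        by (metis (no_types, lifting) sequentially_bot)
      define d where "d = t0 / (1 + real j)"
      have d: "0 < d" "d < d0" "2 * d < b"
        using j t0 unfolding d_def by (simp, linarith, linarith)
      obtain N where N: "M / d < real N"
        using reals_Archimedean2 by blast
      have M: "M \<le> real (Suc N) * d"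
        using N d by (simp add: field_simps)
      let ?G1 = "\<lambda>z. J {d<..2 * d} z * indicator K z"
      let ?G2 = "\<lambda>z. J {d<..2 * d} z * indicator (-K) z"
      have "(\<integral>\<^sup>+x. (J {d0<..M} x - C) \<partial>m) \<le> (\<integral>\<^sup>+x. U d ?G2 N x \<partial>m)"
      proof (rule nn_integral_mono)
        fix x
        have "J {d0<..M} x \<le> J {d<..real (Suc N) * d} x"
          using d M by (intro J_mono) auto
        also have "\<dots> = U d (J {d<..2 * d}) N x"
          by (rule U_J[OF d(1), symmetric])
        also have "J {d<..2 * d} = (\<lambda>z. ?G1 z + ?G2 z)"
          by (auto split: split_indicator)
        also have "U d \<dots> N x = U d ?G1 N x + U d ?G2 N x"
          by (rule U_add) measurable
        also have "\<dots> \<le> C + U d ?G2 N x"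
          using U_on[OF j(1) d_def] by (rule add_right_mono)
        finally show "J {d0<..M} x - C \<le> U d ?G2 N x"
          by (auto simp: C_def ennreal_minus_le_iff)
      qed
      also have "\<dots> \<le> ennreal (1 / (1 - exp (- d))) * (\<integral>\<^sup>+z. ?G2 z \<partial>m)"
        using d by (intro nn_integral_U_le) auto
      also have "\<dots> \<le> ennreal e"
        using d small by (intro nn_integral_J_off_le) (auto intro: less_imp_le)
      finally show "(\<integral>\<^sup>+x. (J {d0<..M} x - C) \<partial>m) \<le> 0 + ennreal e"
        by simp
    qed
  qed simp
  have "AE x in m. J {d0<..M} x \<le> C" if "0 < d0" for d0 M
  proof -
    have "AE x in m. J {d0<..M} x - C = 0"
      using excess_0[OF that] by (subst (asm) nn_integral_0_iff_AE) auto
    then show ?thesis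
      by eventually_elim (rule ennreal_minus_eq_0)
  qed
  \<comment> \<open>Countably many windows exhaust the positive times, so one null set serves for
    all of them.\<close>
  then have "AE x in m. \<forall>n. J {1 / real (Suc n)<..real n} x \<le> C"
    by (subst AE_all_countable) simp
  then have AE_le: "AE x in m. J {0<..} x \<le> C"
  proof eventually_elim
    case (elim x)
    have "(\<Union>n. {1 / real (Suc n)<..real n}) = {0<..}"
    proof safe
      fix s :: real assume "0 < s"
      then have "eventually (\<lambda>n. 1 / real (Suc n) < s) sequentially"
        using order_tendstoD(2)[OF LIMSEQ_Suc[OF lim_1_over_n[where 'a=real]]] by simp
      moreover have "eventually (\<lambda>n. s \<le> real n) sequentially"
        using filterlim_real_sequentially unfolding filterlim_at_top by blast
      ultimately have "eventually (\<lambda>n. 1 / real (Suc n) < s \<and> s \<le> real n) sequentially"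
        by (rule eventually_conj)
      then show "s \<in> (\<Union>n. {1 / real (Suc n)<..real n})"
        by (auto simp: eventually_sequentially)
    qed (auto intro: less_trans[rotated])
    moreover have "incseq (\<lambda>n. {1 / real (Suc n)<..real n})"
      by (intro incseq_SucI) (auto simp del: of_nat_Suc intro: order.strict_trans1[OF inverse_Suc_antimono])
    ultimately have "J {0<..} x = (SUP n. J {1 / real (Suc n)<..real n} x)"
      by (subst J_SUP) auto
    then show ?case
      using elim by (auto intro: SUP_least)
  qed
  \<comment> \<open>Here the exceptional null set disappears; afterwards \<open>d\<close> decreases
    to 0 at the fixed point \<open>x\<close>.\<close>
  have shifted: "J {d<..} x \<le> C" if d: "0 < d" for d
  proof -
    have "J {d<..} x \<le> ennreal (exp (- d)) * C"
      using d AE_le by (rule J_tail_le)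
    also have "\<dots> \<le> 1 * C"
      using d by (intro mult_right_mono) auto
    finally show ?thesis
      by simp
  qed
  have "(\<Union>n. {1 / real (Suc n)<..}) = {0<..}"
  proof safe
    fix s :: real assume "0 < s"
    then show "s \<in> (\<Union>n. {1 / real (Suc n)<..})"
      using reals_Archimedean[of s] by (auto simp: inverse_eq_divide)
  qed (auto intro: less_trans[rotated])
  moreover have "incseq (\<lambda>n. {1 / real (Suc n)<..})"
    by (intro incseq_SucI) (auto simp del: of_nat_Suc intro: inverse_Suc_antimono order.strict_trans1[OF inverse_Suc_antimono])
  ultimately have "J {0<..} x = (SUP n. J {1 / real (Suc n)<..} x)"
    by (subst J_SUP) auto
  also have "\<dots> \<le> C"
    by (intro SUP_least shifted) simp
  finally show ?thesis
    by (simp add: C_def q_def)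
qed

end

section \<open>The kernel of a pair of dual processes\<close>

context dual_standard_processes
begin

text \<open>The density is measurable only on positive times, whereas \<open>dual_kernel\<close>
  demands a kernel measurable on the whole line. Extension by 0 achieves this and leaves integrals
  over positive times unchanged.\<close>

definition q :: "real \<Rightarrow> 'a \<Rightarrow> 'a \<Rightarrow> ennreal" where
  "q t x y = (if 0 < t then p t x y else 0)"

text \<open>The two masses are the probabilities that the process, respectively its dual, has not
  reached the cemetery by time \<open>t\<close>, hence at most 1.\<close>

lemma dual_kernel: "dual_kernel m q"
proof -
  interpret sigma_finite_measure m
    by (rule sigma_finite_m)
  show ?thesis
  proof
    have "(\<lambda>w. if w \<in> {0<..} \<times> UNIV then (\<lambda>(t, x, y). p t x y) w else 0) \<in> borel_measurable borel"
      using density_measurable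
      by (subst measurable_restrict_space_iff[symmetric])
        (auto intro!: borel_open open_Times)
    also have "(\<lambda>w. if w \<in> {0<..} \<times> UNIV then (\<lambda>(t, x, y). p t x y) w else 0) = (\<lambda>(t, x, y). q t x y)"
      by (auto simp: q_def fun_eq_iff)
    finally show "(\<lambda>(t, x, y). q t x y) \<in> borel_measurable borel" .
  next
    fix t :: real and x :: 'a assume t: "0 < t"
    interpret P: prob_space "law X (Some x)"
      by (rule X.prob_law)
    have "(\<integral>\<^sup>+y. q t x y \<partial>m) = emeasure (law X (Some x))
        {\<omega>\<in>space (events X). coord X (ennreal t) \<omega> \<in> Some ` UNIV}"
      using density[OF t, of UNIV x] t by (simp add: q_def)
    then show "(\<integral>\<^sup>+y. q t x y \<partial>m) \<le> 1"
      using P.emeasure_le_1 by simp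
  next
    fix t :: real and y :: 'a assume t: "0 < t"
    interpret P: prob_space "law Xh (Some y)"
      by (rule Xh.prob_law)
    have "(\<integral>\<^sup>+x. q t x y \<partial>m) = emeasure (law Xh (Some y))
        {\<omega>\<in>space (events Xh). coord Xh (ennreal t) \<omega> \<in> Some ` UNIV}"
      using dual_density[OF t, of UNIV y] t by (simp add: q_def)
    then show "(\<integral>\<^sup>+x. q t x y \<partial>m) \<le> 1"
      using P.emeasure_le_1 by simp
  next
    fix s t :: real and x y :: 'a assume "0 < s" "0 < t"
    then show "q (t + s) x y = (\<integral>\<^sup>+z. q t x z * q s z y \<partial>m)"
      using Chapman_Kolmogorov by (simp add: q_def)
  qed (rule sets_m)
qed

text \<open>After Tonelli, the inner integral is the probability that the dual process started at
  \<open>y\<close> is in the complement of \<open>K\<close> at time \<open>r\<close>. For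
  \<open>y\<close> in the interior of \<open>K\<close> it tends to 0, since paths start at
  \<open>y\<close> and are right-continuous; finiteness of \<open>\<mu>\<close> allows dominated
  convergence.\<close>

lemma escape_tendsto_0:
  fixes \<mu> :: "'a measure"
  assumes "finite_measure \<mu>" and sets_mu [measurable_cong]: "sets \<mu> = sets borel"
    and K: "closed K" and supp: "AE y in \<mu>. y \<in> interior K"
  shows "((\<lambda>r. \<integral>\<^sup>+z\<in>-K. (\<integral>\<^sup>+y. q r z y \<partial>\<mu>) \<partial>m) \<longlongrightarrow> 0) (at_right 0)"
\<comment> \<open>Dominated convergence is available along sequences of times.\<close>
proof (rule tendsto_at_right_sequentially)
  show "(0::real) < 1" by simp
  fix r :: "nat \<Rightarrow> real"
  assume r0: "\<And>n. 0 < r n" and r: "r \<longlonglongrightarrow> 0"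
  interpret dual_kernel m q by (rule dual_kernel)
  interpret mu: finite_measure \<mu> by fact
  interpret mm: pair_sigma_finite \<mu> m ..
  have [measurable]: "K \<in> sets borel"
    using K by simp
  have inner: "(\<lambda>n. \<integral>\<^sup>+z\<in>-K. q (r n) z y \<partial>m) \<longlonglongrightarrow> 0" if y: "y \<in> interior K" for y
  proof -
    let ?P = "law Xh (Some y)"
    interpret P: prob_space ?P
      by (rule Xh.prob_law)
    have spP: "space ?P = space (events Xh)"
      by (rule sets_eq_imp_space_eq[OF Xh.sets_law])
    have open_K: "Some ` (-K) \<in> sets cemetery_borel"
      using K by (auto simp: cemetery_borel_def intro!: sigma_sets.Basic)
    let ?A = "\<lambda>n. {\<omega>\<in>space (events Xh). coord Xh (ennreal (r n)) \<omega> \<in> Some ` (-K)}"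
    have A: "?A n \<in> sets ?P" for n
      using measurable_sets[OF Xh.coord_measurable open_K, of "ennreal (r n)"]
      by (simp add: Xh.sets_law vimage_def Int_def conj_commute)
    \<comment> \<open>Paths are indexed by \<open>ennreal\<close>, so the real times are transported
      to the right neighbourhood filter of 0 there.\<close>
    have r_filter: "filterlim (\<lambda>n. ennreal (r n)) (at_right 0) sequentially"
      unfolding filterlim_at using r r0
      by (auto intro!: tendsto_eq_intros always_eventually simp: less_imp_neq[symmetric])
    have "(\<lambda>n. \<integral>\<^sup>+\<omega>. indicator (?A n) \<omega> \<partial>?P) \<longlonglongrightarrow> (\<integral>\<^sup>+\<omega>. 0 \<partial>?P)"
    proof (rule nn_integral_dominated_convergence)
      show "AE \<omega> in ?P. (\<lambda>n. indicator (?A n) \<omega> :: ennreal) \<longlonglongrightarrow> 0"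
        using Xh.normal[of "Some y"] AE_space
      proof eventually_elim
        case (elim \<omega>)
        then have \<omega>: "\<omega> \<in> space (events Xh)"
          by (simp add: spP)
        have "limitin cemetery_topology (\<lambda>s. coord Xh s \<omega>) (Some y) (at_right 0)"
          using Xh.right_continuous[OF \<omega>, of 0] elim by simp
        moreover have "openin cemetery_topology (Some ` interior K)"
          by simp
        ultimately have "eventually (\<lambda>s. coord Xh s \<omega> \<in> Some ` interior K) (at_right 0)"
          using y unfolding limitin_def by blast
        then have "eventually (\<lambda>n. coord Xh (ennreal (r n)) \<omega> \<in> Some ` interior K) sequentially"
          using r_filter by (rule eventually_compose_filterlim)
        then have "eventually (\<lambda>n. indicator (?A n) \<omega> = (0::ennreal)) sequentially"
          by eventually_elim (use interior_subset[of K] in \<open>auto simp: indicator_def\<close>)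
        then show ?case
          by (rule tendsto_eventually)
      qed
      show "AE \<omega> in ?P. indicator (?A n) \<omega> \<le> (1::ennreal)" for n
        by (auto simp: indicator_def)
    qed (use A P.emeasure_space_1 in auto)
    moreover have "(\<integral>\<^sup>+\<omega>. indicator (?A n) \<omega> \<partial>?P) = (\<integral>\<^sup>+z\<in>-K. q (r n) z y \<partial>m)" for n
      using dual_density[OF r0[of n], of "-K" y] A[of n] r0[of n] by (simp add: q_def)
    ultimately show ?thesis
      by simp
  qed
  have "(\<lambda>n. \<integral>\<^sup>+y. (\<integral>\<^sup>+z\<in>-K. q (r n) z y \<partial>m) \<partial>\<mu>) \<longlonglongrightarrow> (\<integral>\<^sup>+y. 0 \<partial>\<mu>)"
  proof (rule nn_integral_dominated_convergence)
    show "AE y in \<mu>. (\<lambda>n. \<integral>\<^sup>+z\<in>-K. q (r n) z y \<partial>m) \<longlonglongrightarrow> 0"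
      using supp by eventually_elim (rule inner)
    show "AE y in \<mu>. (\<integral>\<^sup>+z\<in>-K. q (r n) z y \<partial>m) \<le> 1" for n
    proof (rule AE_I2)
      fix y
      have "(\<integral>\<^sup>+z\<in>-K. q (r n) z y \<partial>m) \<le> (\<integral>\<^sup>+z. q (r n) z y \<partial>m)"
        by (intro nn_integral_mono) (auto split: split_indicator)
      then show "(\<integral>\<^sup>+z\<in>-K. q (r n) z y \<partial>m) \<le> 1"
        using dual_mass_le_1[OF r0] by (rule order_trans)
    qed
    show "(\<integral>\<^sup>+y. 1 \<partial>\<mu>) < \<infinity>"
      using mu.emeasure_finite by (simp add: less_top[symmetric])
  qed measurable
  moreover have "(\<integral>\<^sup>+y. (\<integral>\<^sup>+z\<in>-K. q (r n) z y \<partial>m) \<partial>\<mu>)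
      = (\<integral>\<^sup>+z\<in>-K. (\<integral>\<^sup>+y. q (r n) z y \<partial>\<mu>) \<partial>m)" for n
  proof -
    have "(\<integral>\<^sup>+y. (\<integral>\<^sup>+z\<in>-K. q (r n) z y \<partial>m) \<partial>\<mu>) = (\<integral>\<^sup>+z. \<integral>\<^sup>+y. q (r n) z y * indicator (-K) z \<partial>\<mu> \<partial>m)"
      by (rule mm.Fubini'[symmetric]) measurable
    also have "\<dots> = (\<integral>\<^sup>+z\<in>-K. (\<integral>\<^sup>+y. q (r n) z y \<partial>\<mu>) \<partial>m)"
      by (intro nn_integral_cong nn_integral_multc) measurable
    finally show ?thesis .
  qed
  ultimately show "(\<lambda>n. \<integral>\<^sup>+z\<in>-K. (\<integral>\<^sup>+y. q (r n) z y \<partial>\<mu>) \<partial>m) \<longlonglongrightarrow> 0"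
    by simp
qed

end

section \<open>Weak convergence on a compact set\<close>

text \<open>The complement of the support is covered by null open sets, and by second countability
  by countably many null basic ones.\<close>

lemma AE_topological_support:
  fixes \<nu> :: "'a::second_countable_topology measure"
  assumes "sets \<nu> = sets borel"
  shows "AE x in \<nu>. x \<in> topological_support \<nu>"
proof -
  obtain B :: "'a set set" where B: "countable B" "topological_basis B"
    using ex_countable_basis[where 'a='a] by auto
  define N where "N = {b \<in> B. emeasure \<nu> b = 0}"
  have "\<Union>N \<in> null_sets \<nu>"
  proof (rule null_sets_UN'[of N "\<lambda>b. b", simplified])
    show "countable N"
      using B(1) unfolding N_def by (rule countable_subset[rotated]) auto
    show "b \<in> null_sets \<nu>" if "b \<in> N" for b
      using that topological_basis_open[OF B(2)] by (auto simp: N_def null_sets_def assms)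
  qed
  moreover have "{x \<in> space \<nu>. x \<notin> topological_support \<nu>} \<subseteq> \<Union>N"
  proof safe
    fix x assume "x \<notin> topological_support \<nu>"
    then obtain V where V: "open V" "x \<in> V" "emeasure \<nu> V = 0"
      by (auto simp: topological_support_def)
    obtain b where "b \<in> B" "x \<in> b" "b \<subseteq> V"
      using topological_basisE[OF B(2) V(1,2)] by blast
    moreover have "emeasure \<nu> b \<le> emeasure \<nu> V"
      using V(1) \<open>b \<subseteq> V\<close> assms by (intro emeasure_mono) auto
    ultimately show "x \<in> \<Union>N"
      using V(3) by (auto simp: N_def)
  qed
  ultimately show ?thesis
    by (rule AE_I')
qed

text \<open>Finitely many open sets, each inside a compact set, cover \<open>K0\<close>. Having
  \<open>K0\<close> in the interior is what lets the dual process started in \<open>K0\<close> stay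
  in \<open>K\<close> for short times.\<close>

lemma compact_neighbourhood:
  fixes K0 :: "'a::t2_space set"
  assumes "locally_compact_space (euclidean :: 'a topology)" and "compact K0"
  obtains K where "compact K" "K0 \<subseteq> interior K"
proof -
  let ?\<U> = "{U :: 'a set. open U \<and> (\<exists>C. compact C \<and> U \<subseteq> C)}"
  have "K0 \<subseteq> \<Union>?\<U>"
  proof
    fix x :: 'a
    obtain U C where "openin euclidean U" "compactin euclidean C" "x \<in> U" "U \<subseteq> C"
      using assms(1) unfolding locally_compact_space_def topspace_euclidean by blast
    then show "x \<in> \<Union>?\<U>"
      by auto
  qed
  then obtain D where D: "D \<subseteq> ?\<U>" "finite D" "K0 \<subseteq> \<Union>D"
    by (rule compactE[OF assms(2)]) auto
  from D(2,1) have "\<exists>K. compact K \<and> \<Union>D \<subseteq> K"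
  proof (induction D)
    case empty
    then show ?case
      by auto
  next
    case (insert U D)
    then obtain K C where "compact K" "\<Union>D \<subseteq> K" "compact C" "U \<subseteq> C"
      by auto
    then have "compact (C \<union> K)" "\<Union>(insert U D) \<subseteq> C \<union> K"
      by auto
    then show ?case
      by blast
  qed
  then obtain K where K: "compact K" "\<Union>D \<subseteq> K"
    by blast
  moreover have "open (\<Union>D)"
    using D(1) by auto
  ultimately have "K0 \<subseteq> interior K"
    using D(3) interior_maximal by blast
  with K(1) show ?thesis
    by (rule that)
qed

lemma integrable_continuous_on_compact:
  fixes f :: "'a::metric_space \<Rightarrow> real"
  assumes "finite_measure M" "sets M = sets borel" "AE x in M. x \<in> K" "compact K"
    and "continuous_on K f" "f \<in> borel_measurable borel"
  shows "integrable M f"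
proof -
  interpret finite_measure M by fact
  have "bounded (f ` K)"
    using assms by (intro compact_imp_bounded compact_continuous_image)
  then obtain B where "\<And>x. x \<in> K \<Longrightarrow> norm (f x) \<le> B"
    by (auto simp: bounded_iff)
  then have "AE x in M. norm (f x) \<le> B"
    using assms(3) by auto
  moreover have "f \<in> borel_measurable M"
    using assms(6) by (simp add: measurable_cong_sets[OF assms(2) refl])
  ultimately show ?thesis
    by (intro integrable_const_bound)
qed

locale weak_limit_on_compact = mu: finite_measure \<mu>
  for \<mu> :: "'a::{metric_space, second_countable_topology} measure" and \<nu> :: "nat \<Rightarrow> 'a measure"
    and K0 :: "'a set" +
  assumes sets_mu [measurable_cong]: "sets \<mu> = sets borel"
    and finite_nu: "finite_measure (\<nu> n)"
    and sets_nu [measurable_cong]: "sets (\<nu> n) = sets borel"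
    and compact_K0: "compact K0"
    and AE_mu: "AE x in \<mu>. x \<in> K0"
    and AE_nu: "AE x in \<nu> n. x \<in> K0"
    and weak: "weakly_converges \<nu> \<mu>"
begin

lemmas integrable_mu = integrable_continuous_on_compact[OF mu.finite_measure_axioms sets_mu AE_mu compact_K0]
lemmas integrable_nu = integrable_continuous_on_compact[OF finite_nu sets_nu AE_nu compact_K0]

text \<open>Continuity is given on \<open>K0\<close> only. A bounded Tietze extension is an
  admissible test function and agrees with \<open>f\<close> almost everywhere for each of the
  measures.\<close>

lemma tendsto_integral:
  fixes f :: "'a \<Rightarrow> real"
  assumes f: "continuous_on K0 f" and [measurable]: "f \<in> borel_measurable borel"
  shows "(\<lambda>n. \<integral>x. f x \<partial>\<nu> n) \<longlonglongrightarrow> (\<integral>x. f x \<partial>\<mu>)"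
proof -
  have "bounded (f ` K0)"
    using f compact_K0 by (intro compact_imp_bounded compact_continuous_image)
  then obtain B where B: "0 \<le> B" "\<And>x. x \<in> K0 \<Longrightarrow> norm (f x) \<le> B"
    by (auto simp: bounded_pos intro: less_imp_le)
  obtain g where g: "continuous_on UNIV g" "\<And>x. x \<in> K0 \<Longrightarrow> g x = f x" "\<And>x. norm (g x) \<le> B"
    using Tietze[OF f _ B, of UNIV] compact_K0 compact_imp_closed by auto
  have [measurable]: "g \<in> borel_measurable borel"
    using g(1) by (rule borel_measurable_continuous_onI)
  have "(\<lambda>n. \<integral>x. g x \<partial>\<nu> n) \<longlonglongrightarrow> (\<integral>x. g x \<partial>\<mu>)"
    using weak g(1,3) unfolding weakly_converges_def by (auto simp: bounded_iff)
  moreover have "(\<integral>x. g x \<partial>\<nu> n) = (\<integral>x. f x \<partial>\<nu> n)" for n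
    using AE_nu[of n] g(2) by (intro integral_cong_AE) (measurable, auto)
  moreover have "(\<integral>x. g x \<partial>\<mu>) = (\<integral>x. f x \<partial>\<mu>)"
    using AE_mu g(2) by (intro integral_cong_AE) (measurable, auto)
  ultimately show ?thesis
    by simp
qed

text \<open>Uniform continuity on \<open>L \<times> K0\<close> reduces the parameters to a finite
  net, on which pointwise convergence is uniform.\<close>

lemma uniformly_tendsto_integral:
  fixes f :: "'b::metric_space \<Rightarrow> 'a \<Rightarrow> real"
  assumes L: "compact L" and f: "continuous_on (L \<times> K0) (\<lambda>(u, y). f u y)"
    and f_measurable: "\<And>u. u \<in> L \<Longrightarrow> f u \<in> borel_measurable borel" and e: "0 < e"
  shows "eventually (\<lambda>n. \<forall>u\<in>L. \<bar>(\<integral>y. f u y \<partial>\<nu> n) - (\<integral>y. f u y \<partial>\<mu>)\<bar> \<le> e) sequentially"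
proof -
  have f_u: "continuous_on K0 (f u)" if "u \<in> L" for u
  proof -
    have "continuous_on K0 ((\<lambda>(u, y). f u y) \<circ> Pair u)"
      using that by (intro continuous_on_compose continuous_on_subset[OF f] continuous_intros) auto
    then show ?thesis
      by (simp add: o_def)
  qed
  have int: "integrable (\<nu> n) (f u)" "integrable \<mu> (f u)" if "u \<in> L" for n u
    by (rule integrable_nu[OF f_u[OF that] f_measurable[OF that]],
        rule integrable_mu[OF f_u[OF that] f_measurable[OF that]])
  \<comment> \<open>Strictly above the limit mass, so that it eventually bounds the masses of all
    \<open>\<nu> n\<close> as well.\<close>
  define M where "M = measure \<mu> UNIV + 1"
  have M: "0 < M"
    by (simp add: M_def add_nonneg_pos)
  have sp: "space (\<nu> n) = UNIV" "space \<mu> = UNIV" for n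
    using sets_eq_imp_space_eq[OF sets_nu] sets_eq_imp_space_eq[OF sets_mu] by simp_all
  have "(\<lambda>n. measure (\<nu> n) UNIV) \<longlonglongrightarrow> measure \<mu> UNIV"
    using tendsto_integral[of "\<lambda>_. 1"] by (simp add: sp)
  then have mass: "eventually (\<lambda>n. measure (\<nu> n) UNIV < M) sequentially"
    by (rule order_tendstoD) (simp add: M_def)
  \<comment> \<open>Moving to a net point costs at most \<open>M * e1 = e / 4\<close> for each of
    the two measures; the remaining \<open>e / 2\<close> is left for the net points.\<close>
  define e1 where "e1 = e / (4 * M)"
  have e1: "0 < e1"
    using e M by (simp add: e1_def)
  have "uniformly_continuous_on (L \<times> K0) (\<lambda>(u, y). f u y)"
    using f L compact_K0 by (intro compact_uniformly_continuous compact_Times)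
  then obtain \<delta> where \<delta>: "0 < \<delta>" and
    near: "\<And>w w'. w \<in> L \<times> K0 \<Longrightarrow> w' \<in> L \<times> K0 \<Longrightarrow> dist w' w < \<delta> \<Longrightarrow>
      dist (case w' of (u, y) \<Rightarrow> f u y) (case w of (u, y) \<Rightarrow> f u y) < e1"
    using e1 unfolding uniformly_continuous_on_def by blast
  have near': "\<bar>f u y - f v y\<bar> \<le> e1" if "u \<in> L" "v \<in> L" "dist u v < \<delta>" "y \<in> K0" for u v y
    using near[of "(v, y)" "(u, y)"] that by (simp add: dist_Pair_Pair dist_real_def)
  have "L \<subseteq> (\<Union>u\<in>L. ball u \<delta>)"
    using \<delta> by auto
  then obtain F where F: "F \<subseteq> L" "finite F" "L \<subseteq> (\<Union>u\<in>F. ball u \<delta>)"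
    by (rule compactE_image[OF L open_ball])
  have "eventually (\<lambda>n. \<forall>v\<in>F. \<bar>(\<integral>y. f v y \<partial>\<nu> n) - (\<integral>y. f v y \<partial>\<mu>)\<bar> < e / 2) sequentially"
  proof (rule eventually_ball_finite[OF F(2)], rule ballI)
    fix v assume "v \<in> F"
    then have "v \<in> L"
      using F(1) by blast
    then have "(\<lambda>n. \<integral>y. f v y \<partial>\<nu> n) \<longlonglongrightarrow> (\<integral>y. f v y \<partial>\<mu>)"
      by (intro tendsto_integral f_u f_measurable)
    then show "eventually (\<lambda>n. \<bar>(\<integral>y. f v y \<partial>\<nu> n) - (\<integral>y. f v y \<partial>\<mu>)\<bar> < e / 2) sequentially"
      using e unfolding tendsto_iff dist_real_def by (meson half_gt_zero)
  qed
  with mass show ?thesis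
  proof eventually_elim
    case (elim n)
    show ?case
    proof
      fix u assume u: "u \<in> L"
      then obtain v where v: "v \<in> F" "dist u v < \<delta>"
        using F(3) by (auto simp: dist_commute)
      then have "v \<in> L"
        using F(1) by auto
      have close: "\<bar>(\<integral>y. f u y \<partial>N) - (\<integral>y. f v y \<partial>N)\<bar> \<le> e / 4"
        if N: "finite_measure N" "sets N = sets borel" "AE y in N. y \<in> K0" "measure N UNIV \<le> M"
          "integrable N (f u)" "integrable N (f v)" for N
      proof -
        interpret finite_measure N by fact
        have "space N = UNIV"
          using sets_eq_imp_space_eq[OF N(2)] by simp
        have "\<bar>(\<integral>y. f u y \<partial>N) - (\<integral>y. f v y \<partial>N)\<bar> = \<bar>\<integral>y. f u y - f v y \<partial>N\<bar>"
          using N by simp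
        also have "\<dots> \<le> (\<integral>y. \<bar>f u y - f v y\<bar> \<partial>N)"
          by (rule integral_abs_bound)
        also have "\<dots> \<le> (\<integral>y. e1 \<partial>N)"
          using N u v \<open>v \<in> L\<close> near' by (intro integral_mono_AE) auto
        also have "\<dots> \<le> M * e1"
          using N(4) e1 \<open>space N = UNIV\<close> by simp
        also have "\<dots> = e / 4"
          using M by (simp add: e1_def)
        finally show ?thesis .
      qed
      have "\<bar>(\<integral>y. f u y \<partial>\<nu> n) - (\<integral>y. f v y \<partial>\<nu> n)\<bar> \<le> e / 4"
        using elim u \<open>v \<in> L\<close> by (intro close finite_nu sets_nu AE_nu int) auto
      moreover have "\<bar>(\<integral>y. f u y \<partial>\<mu>) - (\<integral>y. f v y \<partial>\<mu>)\<bar> \<le> e / 4"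
        using u \<open>v \<in> L\<close> by (intro close mu.finite_measure_axioms sets_mu AE_mu int) (auto simp: M_def)
      moreover have "\<bar>(\<integral>y. f v y \<partial>\<nu> n) - (\<integral>y. f v y \<partial>\<mu>)\<bar> < e / 2"
        using elim v by blast
      ultimately show "\<bar>(\<integral>y. f u y \<partial>\<nu> n) - (\<integral>y. f u y \<partial>\<mu>)\<bar> \<le> e"
        by linarith
    qed
  qed
qed

end

section \<open>Convergence of potentials\<close>

locale continuous_kernel_limit = dual_kernel m p + weak_limit_on_compact \<mu> \<nu> K0
  for m :: "'a::{metric_space, second_countable_topology} measure" and p and \<mu> :: "'a measure" and \<nu> K0 +
  assumes kernel_finite: "0 < t \<Longrightarrow> p t x y < \<infinity>"
    and kernel_continuous:
      "continuous_on ({0<..} \<times> (UNIV :: ('a \<times> 'a) set)) (\<lambda>(t, x, y). p t x y)"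

sublocale continuous_kernel_limit \<subseteq> limit: dual_kernel_measure m p \<mu>
  by unfold_locales (rule sets_mu)

sublocale continuous_kernel_limit \<subseteq> approx: dual_kernel_measure m p "\<nu> n" for n
  by (intro dual_kernel_measure.intro dual_kernel_axioms finite_nu dual_kernel_measure_axioms.intro sets_nu)

context continuous_kernel_limit
begin

section \<open>Pointwise and uniform convergence of the heat integrals\<close>

lemma continuous_enn2real_kernel:
  "continuous_on ({0<..} \<times> UNIV) (\<lambda>(t, x, y). enn2real (p t x y))"
  unfolding continuous_on_def
proof safe
  fix t :: real and x y :: 'a assume t: "0 < t"
  have "((\<lambda>(t, x, y). p t x y) \<longlongrightarrow> p t x y) (at (t, x, y) within {0<..} \<times> UNIV)"
    using kernel_continuous t unfolding continuous_on_def by fastforce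
  then have "((\<lambda>w. enn2real (case w of (t, x, y) \<Rightarrow> p t x y)) \<longlongrightarrow> enn2real (p t x y))
      (at (t, x, y) within {0<..} \<times> UNIV)"
    using kernel_finite[OF t, of x y] by (intro tendsto_enn2real) (auto simp: ennreal_enn2real)
  then show "((\<lambda>(t, x, y). enn2real (p t x y)) \<longlongrightarrow> enn2real (p t x y))
      (at (t, x, y) within {0<..} \<times> UNIV)"
    by (simp add: case_prod_unfold)
qed

lemma continuous_enn2real_kernel_space:
  assumes "0 < s"
  shows "continuous_on A (\<lambda>y. enn2real (p s x y))"
proof -
  have "continuous_on A ((\<lambda>(t, x, y). enn2real (p t x y)) \<circ> (\<lambda>y. (s, x, y)))"
    using assms
    by (intro continuous_on_compose continuous_on_subset[OF continuous_enn2real_kernel] continuous_intros) auto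
  then show ?thesis
    by (simp add: o_def)
qed

lemma heat_eq:
  assumes s: "0 < s"
  shows "(\<integral>\<^sup>+y. p s x y \<partial>\<mu>) = ennreal (\<integral>y. enn2real (p s x y) \<partial>\<mu>)"
    and "(\<integral>\<^sup>+y. p s x y \<partial>\<nu> n) = ennreal (\<integral>y. enn2real (p s x y) \<partial>\<nu> n)"
proof -
  have *: "(\<integral>\<^sup>+y. p s x y \<partial>N) = (\<integral>\<^sup>+y. ennreal (enn2real (p s x y)) \<partial>N)" for N
    using kernel_finite[OF s] by (intro nn_integral_cong) (simp add: ennreal_enn2real)
  have meas: "(\<lambda>y. enn2real (p s x y)) \<in> borel_measurable borel"
    by measurable
  show "(\<integral>\<^sup>+y. p s x y \<partial>\<mu>) = ennreal (\<integral>y. enn2real (p s x y) \<partial>\<mu>)"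
    unfolding * using integrable_mu[OF continuous_enn2real_kernel_space[OF s] meas]
    by (rule nn_integral_eq_integral) simp
  show "(\<integral>\<^sup>+y. p s x y \<partial>\<nu> n) = ennreal (\<integral>y. enn2real (p s x y) \<partial>\<nu> n)"
    unfolding * using integrable_nu[OF continuous_enn2real_kernel_space[OF s] meas]
    by (rule nn_integral_eq_integral) simp
qed

lemma heat_tendsto:
  assumes s: "0 < s"
  shows "(\<lambda>n. \<integral>\<^sup>+y. p s x y \<partial>\<nu> n) \<longlonglongrightarrow> (\<integral>\<^sup>+y. p s x y \<partial>\<mu>)"
  unfolding heat_eq[OF s]
  by (intro tendsto_ennrealI tendsto_integral continuous_enn2real_kernel_space s) measurable

text \<open>For each fixed time the heat integrals converge by weak convergence, so Fatou's lemma in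
  the time variable applies.\<close>

lemma J_limit_le:
  assumes [measurable]: "A \<in> sets borel" and A: "A \<subseteq> {0<..}"
    and le: "\<And>n. approx.J n A x \<le> c"
  shows "limit.J A x \<le> c"
proof -
  let ?g = "\<lambda>n s. ennreal (exp (- s)) * (\<integral>\<^sup>+y. p s x y \<partial>\<nu> n) * indicator A s"
  have "limit.J A x = (\<integral>\<^sup>+s. liminf (\<lambda>n. ?g n s) \<partial>lborel)"
    unfolding limit.J_def
  proof (rule nn_integral_cong)
    fix s :: real
    show "ennreal (exp (- s)) * (\<integral>\<^sup>+y. p s x y \<partial>\<mu>) * indicator A s = liminf (\<lambda>n. ?g n s)"
    proof (cases "s \<in> A")
      case True
      then have "0 < s"
        using A by auto
      then have "(\<lambda>n. ennreal (exp (- s)) * (\<integral>\<^sup>+y. p s x y \<partial>\<nu> n))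
          \<longlonglongrightarrow> ennreal (exp (- s)) * (\<integral>\<^sup>+y. p s x y \<partial>\<mu>)"
        by (intro ennreal_tendsto_cmult heat_tendsto) simp_all
      then show ?thesis
        using True by (simp add: lim_imp_Liminf)
    qed (simp add: Liminf_const)
  qed
  also have "\<dots> \<le> liminf (\<lambda>n. approx.J n A x)"
    unfolding approx.J_def by (rule nn_integral_liminf) measurable
  also have "\<dots> \<le> limsup (\<lambda>n. approx.J n A x)"
    by (rule Liminf_le_Limsup) simp
  also have "\<dots> \<le> c"
    using le by (intro Limsup_bounded) simp
  finally show ?thesis .
qed

text \<open>The pair \<open>(s, x)\<close> is the compact parameter; \<open>0 < a\<close> keeps it
  away from time 0. Two one-sided inequalities replace the absolute difference, since subtraction in
  \<open>ennreal\<close> is truncated.\<close>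

lemma heat_uniform:
  assumes a: "0 < a" and e: "0 < e"
  shows "eventually (\<lambda>n. \<forall>s\<in>{a..b}. \<forall>x\<in>K0.
    (\<integral>\<^sup>+y. p s x y \<partial>\<nu> n) \<le> (\<integral>\<^sup>+y. p s x y \<partial>\<mu>) + ennreal e \<and>
    (\<integral>\<^sup>+y. p s x y \<partial>\<mu>) \<le> (\<integral>\<^sup>+y. p s x y \<partial>\<nu> n) + ennreal e) sequentially"
proof -
  let ?L = "{a..b} \<times> K0"
  let ?f = "\<lambda>u y. enn2real (p (fst u) (snd u) y)"
  have "continuous_on (?L \<times> K0) ((\<lambda>(t, x, y). enn2real (p t x y)) \<circ> (\<lambda>(u, y). (fst u, snd u, y)))"
    unfolding case_prod_unfold using a
    by (intro continuous_on_compose continuous_on_subset[OF continuous_enn2real_kernel[unfolded case_prod_unfold]]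
        continuous_intros) auto
  then have "continuous_on (?L \<times> K0) (\<lambda>(u, y). ?f u y)"
    by (simp add: o_def case_prod_unfold)
  then have "eventually (\<lambda>n. \<forall>u\<in>?L. \<bar>(\<integral>y. ?f u y \<partial>\<nu> n) - (\<integral>y. ?f u y \<partial>\<mu>)\<bar> \<le> e) sequentially"
    using e compact_K0 by (intro uniformly_tendsto_integral compact_Times) (simp_all, measurable)
  then show ?thesis
  proof eventually_elim
    case (elim n)
    show ?case
    proof (intro ballI)
      fix s x assume s: "s \<in> {a..b}" and x: "x \<in> K0"
      have close: "\<bar>(\<integral>y. enn2real (p s x y) \<partial>\<nu> n) - (\<integral>y. enn2real (p s x y) \<partial>\<mu>)\<bar> \<le> e"
        using elim s x by fastforce
      have "0 < s"
        using s a by simp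
      then show "(\<integral>\<^sup>+y. p s x y \<partial>\<nu> n) \<le> (\<integral>\<^sup>+y. p s x y \<partial>\<mu>) + ennreal e \<and>
          (\<integral>\<^sup>+y. p s x y \<partial>\<mu>) \<le> (\<integral>\<^sup>+y. p s x y \<partial>\<nu> n) + ennreal e"
        using close e unfolding heat_eq[OF \<open>0 < s\<close>]
        by (auto simp: ennreal_plus[symmetric] simp del: ennreal_plus intro!: ennreal_leI)
    qed
  qed
qed

section \<open>Uniform convergence of the potentials on the compact carrier\<close>

lemma J_window_uniform:
  assumes a: "0 < a" "a < b" and e: "0 < e"
  shows "eventually (\<lambda>n. \<forall>x\<in>K0.
    approx.J n {a<..b} x \<le> limit.J {a<..b} x + ennreal e \<and>
    limit.J {a<..b} x \<le> approx.J n {a<..b} x + ennreal e) sequentially"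
proof -
  \<comment> \<open>An error of \<open>e / (b - a)\<close> in the heat integrals, with discount at
    most 1, accumulates to \<open>e\<close> over the window.\<close>
  have mono: "(\<integral>\<^sup>+s\<in>{a<..b}. ennreal (exp (- s)) * g s \<partial>lborel)
      \<le> (\<integral>\<^sup>+s\<in>{a<..b}. ennreal (exp (- s)) * h s \<partial>lborel) + ennreal e"
    if [measurable]: "h \<in> borel_measurable borel"
      and le: "\<And>s. s \<in> {a<..b} \<Longrightarrow> g s \<le> h s + ennreal (e / (b - a))" for g h
  proof -
    have "(\<integral>\<^sup>+s\<in>{a<..b}. ennreal (exp (- s)) * g s \<partial>lborel)
        \<le> (\<integral>\<^sup>+s. ennreal (exp (- s)) * h s * indicator {a<..b} s
            + ennreal (e / (b - a)) * indicator {a<..b} s \<partial>lborel)"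
    proof (rule nn_integral_mono)
      fix s :: real
      have "ennreal (exp (- s)) * g s \<le> ennreal (exp (- s)) * h s + ennreal (e / (b - a))"
        if s: "s \<in> {a<..b}"
      proof -
        have "ennreal (exp (- s)) * g s \<le> ennreal (exp (- s)) * (h s + ennreal (e / (b - a)))"
          using le[OF s] by (rule mult_left_mono) simp
        also have "\<dots> = ennreal (exp (- s)) * h s + ennreal (exp (- s)) * ennreal (e / (b - a))"
          by (rule distrib_left)
        also have "\<dots> \<le> ennreal (exp (- s)) * h s + 1 * ennreal (e / (b - a))"
          using s a by (intro add_left_mono mult_right_mono) auto
        finally show ?thesis
          by simp
      qed
      then show "ennreal (exp (- s)) * g s * indicator {a<..b} s
          \<le> ennreal (exp (- s)) * h s * indicator {a<..b} s + ennreal (e / (b - a)) * indicator {a<..b} s"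
        by (auto split: split_indicator)
    qed
    also have "\<dots> = (\<integral>\<^sup>+s\<in>{a<..b}. ennreal (exp (- s)) * h s \<partial>lborel)
        + (\<integral>\<^sup>+s. ennreal (e / (b - a)) * indicator {a<..b} s \<partial>lborel)"
      by (rule nn_integral_add) measurable
    also have "(\<integral>\<^sup>+s. ennreal (e / (b - a)) * indicator {a<..b} s \<partial>lborel) = ennreal e"
      using a e by (subst nn_integral_cmult_indicator) (auto simp: ennreal_mult[symmetric])
    finally show ?thesis .
  qed
  have "0 < e / (b - a)"
    using a e by simp
  from heat_uniform[OF a(1) this, of b] show ?thesis
  proof eventually_elim
    case (elim n)
    show ?case
    proof (intro ballI conjI)
      fix x assume x: "x \<in> K0"
      show "approx.J n {a<..b} x \<le> limit.J {a<..b} x + ennreal e"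
        unfolding limit.J_def approx.J_def using elim x by (intro mono) auto
      show "limit.J {a<..b} x \<le> approx.J n {a<..b} x + ennreal e"
        unfolding limit.J_def approx.J_def using elim x by (intro mono) auto
    qed
  qed
qed

lemma J_uniform:
  assumes small: "\<And>e. 0 < e \<Longrightarrow> \<exists>t>0. \<forall>n. \<forall>x\<in>K0. approx.J n {0<..t} x \<le> ennreal e"
    and bounded: "\<And>n x. approx.J n {0<..} x \<le> ennreal C" and e: "0 < e"
  shows "eventually (\<lambda>n. \<forall>x\<in>K0.
    approx.J n {0<..} x \<le> limit.J {0<..} x + ennreal e \<and>
    limit.J {0<..} x \<le> approx.J n {0<..} x + ennreal e) sequentially"
proof -
  obtain t where t: "0 < t" and small_n: "\<And>n x. x \<in> K0 \<Longrightarrow> approx.J n {0<..t} x \<le> ennreal (e / 3)"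
    using small[of "e / 3"] e by auto
  have small_limit: "limit.J {0<..t} x \<le> ennreal (e / 3)" if "x \<in> K0" for x
    using small_n[OF that] by (intro J_limit_le) auto
  have "((\<lambda>T. exp (- T) * C) \<longlongrightarrow> 0) at_top"
    by real_asymp
  then have "eventually (\<lambda>T. exp (- T) * C < e / 3 \<and> t < T) at_top"
    using e by (intro eventually_conj order_tendstoD eventually_gt_at_top) auto
  then obtain T where T: "exp (- T) * C < e / 3" "t < T"
    by (auto simp: eventually_at_top_linorder)
  have tail: "ennreal (exp (- T)) * ennreal C \<le> ennreal (e / 3)"
    using T by (simp add: ennreal_mult'[symmetric] ennreal_leI)
  have tail_n: "approx.J n {T<..} x \<le> ennreal (e / 3)" for n x
    using approx.J_tail_le[OF _ AE_I2[OF bounded]] t T tail by (meson less_trans order_trans)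
  have "limit.J {0<..} x \<le> ennreal C" for x
    using bounded by (intro J_limit_le) auto
  then have tail_limit: "limit.J {T<..} x \<le> ennreal (e / 3)" for x
    using limit.J_tail_le[OF _ AE_I2] t T tail by (meson less_trans order_trans)
  have split: "{0<..} = {0<..t} \<union> ({t<..T} \<union> {T<..})"
    and disjoint: "{0<..t} \<inter> ({t<..T} \<union> {T<..}) = {}" "{t<..T} \<inter> {T<..} = {}"
    using t T by auto
  have split_n: "approx.J n {0<..} x = approx.J n {0<..t} x + (approx.J n {t<..T} x + approx.J n {T<..} x)" for n x
    unfolding split using disjoint by (simp add: approx.J_union)
  have split_limit: "limit.J {0<..} x = limit.J {0<..t} x + (limit.J {t<..T} x + limit.J {T<..} x)" for x
    unfolding split using disjoint by (simp add: limit.J_union)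
  \<comment> \<open>Only the middle pieces are compared; the first and last pieces are each below
    \<open>e / 3\<close> on their own.\<close>
  have sum3: "u + (v + w) \<le> u' + (v' + w') + ennreal e"
    if "u \<le> ennreal (e / 3)" "v \<le> v' + ennreal (e / 3)" "w \<le> ennreal (e / 3)" for u v w u' v' w' :: ennreal
  proof -
    have "u + (v + w) \<le> ennreal (e / 3) + ((v' + ennreal (e / 3)) + ennreal (e / 3))"
      using that by (intro add_mono)
    also have "\<dots> = v' + (ennreal (e / 3) + ennreal (e / 3) + ennreal (e / 3))"
      by (simp add: ac_simps)
    also have "ennreal (e / 3) + ennreal (e / 3) + ennreal (e / 3) = ennreal e"
      using e by (simp add: ennreal_plus[symmetric] del: ennreal_plus)
    also have "v' + ennreal e \<le> u' + (v' + w') + ennreal e"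
      by (intro add_right_mono) (simp add: add_increasing add_increasing2)
    finally show ?thesis .
  qed
  have "0 < e / 3"
    using e by simp
  from J_window_uniform[OF t T(2) this] show ?thesis
  proof eventually_elim
    case (elim n)
    then show ?case
      unfolding split_n split_limit
      by (intro ballI conjI sum3 small_n small_limit tail_n tail_limit) auto
  qed
qed

end

text \<open>The exceptional set lies in a null cover for each measure, and the intersection of the
  two covers is null for both, hence for the sum.\<close>

lemma AE_measure_add:
  assumes sets: "sets N = sets M" and "AE x in M. P x" "AE x in N. P x"
  shows "AE x in measure_add M N. P x"
proof -
  obtain A where A: "{x \<in> space M. \<not> P x} \<subseteq> A" "emeasure M A = 0" "A \<in> sets M"
    using assms(2) by (rule AE_E)
  obtain B where B: "{x \<in> space N. \<not> P x} \<subseteq> B" "emeasure N B = 0" "B \<in> sets N"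
    using assms(3) by (rule AE_E)
  have "emeasure M (A \<inter> B) = 0" "emeasure N (A \<inter> B) = 0"
    using A B sets emeasure_mono[of "A \<inter> B" A M] emeasure_mono[of "A \<inter> B" B N] by auto
  then have "A \<inter> B \<in> null_sets (measure_add M N)"
    using A B sets by (auto simp: null_sets_def emeasure_measure_add)
  then show ?thesis
    using A B sets_eq_imp_space_eq[OF sets] by (intro AE_I'[of "A \<inter> B"]) auto
qed

lemma Linfty_norm_tendsto_0:
  assumes "\<And>e. 0 < e \<Longrightarrow> eventually (\<lambda>n. AE x in M n. \<bar>f n x\<bar> \<le> ereal e) sequentially"
  shows "(\<lambda>n. Linfty_norm (M n) (f n)) \<longlonglongrightarrow> 0"
proof (rule order_tendstoI)
  fix a :: ereal assume "a < 0"
  moreover have "0 \<le> Linfty_norm (M n) (f n)" for n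
    unfolding Linfty_norm_def by (intro Inf_greatest) auto
  ultimately show "eventually (\<lambda>n. a < Linfty_norm (M n) (f n)) sequentially"
    using less_le_trans by (intro always_eventually) blast
next
  fix a :: ereal assume "0 < a"
  then obtain e where e: "0 < e" "ereal e < a"
    using ereal_dense2[of 0 a] by auto
  from assms[OF e(1)] show "eventually (\<lambda>n. Linfty_norm (M n) (f n) < a) sequentially"
  proof eventually_elim
    case (elim n)
    then have "Linfty_norm (M n) (f n) \<le> ereal e"
      unfolding Linfty_norm_def using e by (intro Inf_lower) auto
    then show ?case
      using e(2) by (rule le_less_trans)
  qed
qed

lemma abs_diff_enn2ereal_le:
  assumes "a \<le> b + ennreal e" "b \<le> a + ennreal e" "a < \<infinity>" "b < \<infinity>" "0 < e"
  shows "\<bar>enn2ereal a - enn2ereal b\<bar> \<le> ereal e"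
proof -
  obtain a' b' where ab: "a = ennreal a'" "0 \<le> a'" "b = ennreal b'" "0 \<le> b'"
    using assms(3,4) by (cases a; cases b) auto
  then have "ennreal a' \<le> ennreal (b' + e)" "ennreal b' \<le> ennreal (a' + e)"
    using assms by simp_all
  then have "a' \<le> b' + e" "b' \<le> a' + e"
    using ab assms(5) by (auto simp: ennreal_le_iff simp del: ennreal_plus)
  then show ?thesis
    using ab by (simp add: enn2ereal_ennreal)
qed

section \<open>Uniform bound and convergence under the assumptions (A1) to (A4)\<close>

theorem theorem4p1:
  fixes X :: "('w, 'a::{metric_space, second_countable_topology}) process"
    and Xh :: "('v, 'a) process"
    and m :: "'a measure"
    and p :: "real \<Rightarrow> 'a \<Rightarrow> 'a \<Rightarrow> ennreal"
    and \<mu> :: "'a measure"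
    and \<mu>s :: "nat \<Rightarrow> 'a measure"
  assumes "locally_compact_space (euclidean :: 'a topology)"
    and "dual_standard_processes X Xh m p"
    and "finite_measure \<mu>" and "sets \<mu> = sets borel"
    and "\<And>n. n \<ge> 1 \<Longrightarrow> finite_measure (\<mu>s n)"
    and "\<And>n. n \<ge> 1 \<Longrightarrow> sets (\<mu>s n) = sets borel"
    and A1_finite: "\<And>t x y. 0 < t \<Longrightarrow> p t x y < \<infinity>"
    and A1_continuous:
      "continuous_on ({0<..} \<times> (UNIV :: ('a \<times> 'a) set)) (\<lambda>(t, x, y). p t x y)"
    and A2: "charges_no_semipolar X \<mu>"
      "\<And>n. n \<ge> 1 \<Longrightarrow> charges_no_semipolar X (\<mu>s n)"
      "weakly_converges \<mu>s \<mu>"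
    and A3: "\<exists>K0. compact K0 \<and> (\<forall>n\<ge>1. topological_support (\<mu>s n) \<subseteq> K0) \<and>
      topological_support \<mu> \<subseteq> K0"
    and A4: "\<And>K. compact K \<Longrightarrow>
      ((\<lambda>t::real. SUP n\<in>{1..}. SUP x\<in>K.
          \<integral>\<^sup>+s\<in>{0<..<t}. (\<integral>\<^sup>+y. p s x y \<partial>\<mu>s n) \<partial>lborel) \<longlongrightarrow> 0) (at_right 0)"
  shows "\<mu> \<in> S00 X p \<and> (\<forall>n\<ge>1. \<mu>s n \<in> S00 X p) \<and>
    (\<lambda>n. Linfty_norm (measure_add (\<mu>s n) \<mu>)
       (\<lambda>x. enn2ereal (potential p (\<mu>s n) x) - enn2ereal (potential p \<mu> x)))
    \<longlonglongrightarrow> 0"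
proof -
  interpret dual_standard_processes X Xh m p
    by fact
  obtain K0 where K0: "compact K0" "\<And>n. n \<ge> 1 \<Longrightarrow> topological_support (\<mu>s n) \<subseteq> K0"
    "topological_support \<mu> \<subseteq> K0"
    using A3 by blast
  obtain K where K: "compact K" "K0 \<subseteq> interior K"
    using compact_neighbourhood[OF assms(1) K0(1)] .
  \<comment> \<open>Nothing is assumed about \<open>\<mu>s 0\<close>; after the shift the hypotheses
    hold for every index.\<close>
  define \<nu> where "\<nu> n = \<mu>s (Suc n)" for n
  have finite_nu: "finite_measure (\<nu> n)" and sets_nu: "sets (\<nu> n) = sets borel"
    and semipolar_nu: "charges_no_semipolar X (\<nu> n)" for n
    using assms(5,6) A2(2) by (simp_all add: \<nu>_def)
  have AE_mu: "AE x in \<mu>. x \<in> K0"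
    using AE_topological_support[OF assms(4)] K0(3) by (auto elim!: eventually_mono)
  have AE_nu: "AE x in \<nu> n. x \<in> K0" for n
    using AE_topological_support[OF sets_nu[of n]] K0(2)[of "Suc n"]
    by (auto simp: \<nu>_def elim!: eventually_mono)
  have "weakly_converges \<nu> \<mu>"
    using A2(3) unfolding weakly_converges_def \<nu>_def by (auto intro: LIMSEQ_Suc)
  then have weak_limit: "weak_limit_on_compact \<mu> \<nu> K0"
    by (intro weak_limit_on_compact.intro weak_limit_on_compact_axioms.intro assms(3,4)
        finite_nu sets_nu K0(1) AE_mu AE_nu)
  interpret continuous_kernel_limit m q \<mu> \<nu> K0
  proof (intro continuous_kernel_limit.intro continuous_kernel_limit_axioms.intro dual_kernel weak_limit)
    show "q t x y < \<infinity>" if "0 < t" for t x y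
      using A1_finite[OF that] that by (simp add: q_def)
    have "continuous_on ({0<..} \<times> (UNIV :: ('a \<times> 'a) set)) (\<lambda>(t, x, y). p t x y)
        = continuous_on ({0<..} \<times> (UNIV :: ('a \<times> 'a) set)) (\<lambda>(t, x, y). q t x y)"
      by (rule continuous_on_cong) (auto simp: q_def)
    with A1_continuous show "continuous_on ({0<..} \<times> (UNIV :: ('a \<times> 'a) set)) (\<lambda>(t, x, y). q t x y)"
      by simp
  qed
  have small: "\<exists>t>0. \<forall>n. \<forall>x\<in>K. approx.J n {0<..t} x \<le> ennreal e" if e: "0 < e" for e
  proof -
    have "eventually (\<lambda>t::real. (SUP n\<in>{1..}. SUP x\<in>K.
        \<integral>\<^sup>+s\<in>{0<..<t}. (\<integral>\<^sup>+y. p s x y \<partial>\<mu>s n) \<partial>lborel) < ennreal e) (at_right 0)"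
      using A4[OF K(1)] e by (intro order_tendstoD) auto
    then obtain b where b: "0 < b" "\<And>t. 0 < t \<Longrightarrow> t < b \<Longrightarrow> (SUP n\<in>{1..}. SUP x\<in>K.
        \<integral>\<^sup>+s\<in>{0<..<t}. (\<integral>\<^sup>+y. p s x y \<partial>\<mu>s n) \<partial>lborel) < ennreal e"
      unfolding eventually_at_right_field by auto
    \<comment> \<open>Passing from \<open>b\<close> to \<open>b / 2\<close> gives a time at which
      the strict bound holds; \<open>b / 4\<close> then fits the half-closed window of
      \<open>J\<close> into the open interval of (A4).\<close>
    have "approx.J n {0<..b / 4} x \<le> ennreal e" if x: "x \<in> K" for n x
    proof -
      have "approx.J n {0<..b / 4} x \<le> (\<integral>\<^sup>+s\<in>{0<..<b / 2}. (\<integral>\<^sup>+y. p s x y \<partial>\<mu>s (Suc n)) \<partial>lborel)"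
        unfolding approx.J_def
      proof (rule nn_integral_mono)
        fix s :: real
        have "ennreal (exp (- s)) * (\<integral>\<^sup>+y. p s x y \<partial>\<nu> n) \<le> 1 * (\<integral>\<^sup>+y. p s x y \<partial>\<nu> n)" if "0 < s"
          using that by (intro mult_right_mono) auto
        then show "ennreal (exp (- s)) * (\<integral>\<^sup>+y. q s x y \<partial>\<nu> n) * indicator {0<..b / 4} s
            \<le> (\<integral>\<^sup>+y. p s x y \<partial>\<mu>s (Suc n)) * indicator {0<..<b / 2} s"
          using b(1) by (auto simp: q_def \<nu>_def split: split_indicator)
      qed
      also have "\<dots> \<le> (SUP x\<in>K. \<integral>\<^sup>+s\<in>{0<..<b / 2}. (\<integral>\<^sup>+y. p s x y \<partial>\<mu>s (Suc n)) \<partial>lborel)"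
        using x by (rule SUP_upper)
      also have "\<dots> \<le> (SUP n\<in>{1..}. SUP x\<in>K.
          \<integral>\<^sup>+s\<in>{0<..<b / 2}. (\<integral>\<^sup>+y. p s x y \<partial>\<mu>s n) \<partial>lborel)"
        by (rule SUP_upper) simp
      also have "\<dots> \<le> ennreal e"
        using b(1) by (intro less_imp_le b(2)) auto
      finally show ?thesis .
    qed
    then show ?thesis
      using b(1) by (intro exI[of _ "b / 4"]) auto
  qed
  obtain t0 where t0: "0 < t0" "\<And>n x. x \<in> K \<Longrightarrow> approx.J n {0<..t0} x \<le> 1"
    using small[of 1] by auto
  define C where "C = 1 / (1 - exp (- (t0 / 2)))"
  have bounded_nu: "approx.J n {0<..} x \<le> ennreal C" for n x
    unfolding C_def
  proof (rule approx.J_le)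
    show "((\<lambda>r. \<integral>\<^sup>+z\<in>-K. (\<integral>\<^sup>+y. q r z y \<partial>\<nu> n) \<partial>m) \<longlongrightarrow> 0) (at_right 0)"
      using AE_nu[of n] K by (intro escape_tendsto_0 finite_nu sets_nu) (auto simp: compact_imp_closed elim!: eventually_mono)
    show "K \<in> sets borel"
      using K(1) by (intro borel_closed compact_imp_closed)
  qed (use t0 in auto)
  have bounded_mu: "limit.J {0<..} x \<le> ennreal C" for x
    using bounded_nu by (intro J_limit_le) auto
  \<comment> \<open>The resolvent integrates over positive times, where \<open>p\<close> and
    \<open>q\<close> agree, so the results for \<open>q\<close> transfer to potentials of
    \<open>p\<close>.\<close>
  have resolvent_q: "resolvent_density p = resolvent_density q"
    unfolding resolvent_density_def fun_eq_iff
    by (intro allI nn_integral_cong) (auto simp: q_def split: split_indicator)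
  have potential_mu: "potential p \<mu> x = limit.J {0<..} x" for x
    using limit.potential_eq_J[of x] by (simp add: potential_def resolvent_q)
  have potential_nu: "potential p (\<nu> n) x = approx.J n {0<..} x" for n x
    using approx.potential_eq_J[of n x] by (simp add: potential_def resolvent_q)
  have "(SUP x. potential p \<mu> x) \<le> ennreal C" "(SUP x. potential p (\<nu> n) x) \<le> ennreal C" for n
    using bounded_mu bounded_nu by (auto intro!: SUP_least simp: potential_mu potential_nu)
  then have "(SUP x. potential p \<mu> x) < \<infinity>" "(SUP x. potential p (\<nu> n) x) < \<infinity>" for n
    unfolding infinity_ennreal_def by (blast intro: le_less_trans[OF _ ennreal_less_top])+
  then have "\<mu> \<in> S00 X p" "\<nu> n \<in> S00 X p" for n
    using A2(1) assms(3,4) semipolar_nu finite_nu sets_nu by (auto simp: S00_def)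
  moreover have "\<mu>s n \<in> S00 X p" if "n \<ge> 1" for n
    using calculation(2)[of "n - 1"] that by (simp add: \<nu>_def)
  moreover have "(\<lambda>n. Linfty_norm (measure_add (\<nu> n) \<mu>)
      (\<lambda>x. enn2ereal (potential p (\<nu> n) x) - enn2ereal (potential p \<mu> x))) \<longlonglongrightarrow> 0"
  proof (rule Linfty_norm_tendsto_0)
    fix e :: real assume e: "0 < e"
    have K0_K: "K0 \<subseteq> K"
      using K(2) interior_subset by blast
    have small_K0: "\<exists>t>0. \<forall>n. \<forall>x\<in>K0. approx.J n {0<..t} x \<le> ennreal e" if "0 < e" for e
      using small[OF that] K0_K by blast
    have "eventually (\<lambda>n. \<forall>x\<in>K0.
        approx.J n {0<..} x \<le> limit.J {0<..} x + ennreal e \<and>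
        limit.J {0<..} x \<le> approx.J n {0<..} x + ennreal e) sequentially"
      using small_K0 bounded_nu e by (rule J_uniform)
    then show "eventually (\<lambda>n. AE x in measure_add (\<nu> n) \<mu>.
        \<bar>enn2ereal (potential p (\<nu> n) x) - enn2ereal (potential p \<mu> x)\<bar> \<le> ereal e) sequentially"
    proof eventually_elim
      case (elim n)
      have "AE x in measure_add (\<nu> n) \<mu>. x \<in> K0"
        using AE_nu AE_mu by (intro AE_measure_add) (simp_all add: sets_nu assms(4))
      then show ?case
      proof eventually_elim
        case (elim x)
        show ?case
          unfolding potential_mu potential_nu
        proof (rule abs_diff_enn2ereal_le)
          show "approx.J n {0<..} x < \<infinity>" "limit.J {0<..} x < \<infinity>"
            using bounded_nu[of n x] bounded_mu[of x] by (auto intro: le_less_trans)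
        qed (use \<open>\<forall>x\<in>K0. _\<close> elim e in auto)
      qed
    qed
  qed
  ultimately show ?thesis
    unfolding \<nu>_def by (auto simp: filterlim_sequentially_Suc[of "\<lambda>n. Linfty_norm (measure_add (\<mu>s n) \<mu>)
      (\<lambda>x. enn2ereal (potential p (\<mu>s n) x) - enn2ereal (potential p \<mu> x))"])
qed

end
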